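(* If $F(z,w)\in\mathbb{R}[z_1,\ldots,z_n,w_1,\ldots,w_n]$ is the symbol of an operator in $\mathcal{A}_n(\mathbb{R})$, then $F(\mu z,\lambda w)=F(\mu_1z_1,\ldots,\mu_nz_n,\lambda_1w_1,\ldots,\lambda_nw_n)$ is also the symbol of an operator in $\mathcal{A}_n(\mathbb{R})$ for any $(\mu,\lambda)\in[0,1]^n\times[0,1]^n$. Moreover, the corresponding statement holds for symbols of operators in $\mathcal{A}_n(\mathbb{C})$: if $F(z,w)\in\mathbb{C}[z_1,\ldots,z_n,w_1,\ldots,w_n]$ is the symbol of an operator in $\mathcal{A}_n(\mathbb{C})$, then $F(\mu z,\lambda w)$ is also the symbol of an operator in $\mathcal{A}_n(\mathbb{C})$ for any $(\mu,\lambda)\in[0,1]^n\times[0,1]^n$.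
   Context: A polynomial $f\in\mathbb{C}[z_1,\ldots,z_n]$ is stable if $f(z_1,\ldots,z_n)\neq 0$ whenever $\operatorname{Im}(z_j)>0$ for all $1\le j\le n$; it is real stable if in addition it has real coefficients. $\mathcal{H}_n(\mathbb{C})$ and $\mathcal{H}_n(\mathbb{R})$ denote the sets of stable and real stable polynomials in $n$ variables. $\mathcal{A}_n[\mathbb{C}]$ is the Weyl algebra of operators $T=\sum_{\alpha,\beta\in\mathbb{N}^n}a_{\alpha\beta}z^\alpha\partial^\beta$ (finite sum, $\partial_i=\partial/\partial z_i$, multi-index notation, $a_{\alpha\beta}\in\mathbb{C}$), and $\mathcal{A}_n[\mathbb{R}]$ is the subset of those with all $a_{\alpha\beta}$ real. The symbol of $T$ is the polynomial $F_T(z,w)=\sum_{\alpha,\beta}a_{\alpha\beta}z^\alpha w^\beta$, where $z=(z_1,\ldots,z_n)$ and $w=(w_1,\ldots,w_n)$. A nonzero operator $T\in\mathcal{A}_n[\mathbb{C}]$ is called stability preserving if $T(\mathcal{H}_n(\mathbb{C}))\subseteq\mathcal{H}_n(\mathbb{C})\cup\{0\}$, and real stability preserving if $T(\mathcal{H}_n(\mathbb{R}))\subseteq\mathcal{H}_n(\mathbb{R})\cup\{0\}$. $\mathcal{A}_n(\mathbb{C})\subset\mathcal{A}_n[\mathbb{C}]$ is the set of all stability preservers and $\mathcal{A}_n(\mathbb{R})\subset\mathcal{A}_n[\mathbb{R}]$ is the set of all real stability preservers.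
   Formalization: The conclusion reads "F(μz,λw) is the symbol of an operator in the class, or is 0": operators in the class are nonzero by definition, and F = z_1 with μ_1 = 0 gives the zero symbol, so the literal claim fails exactly when F(μz,λw) = 0. *)

theory Defs
  imports "HOL-Analysis.Analysis" "HOL-Library.Poly_Mapping"
begin

text \<open>
  A polynomial with complex coefficients in the variables indexed by a finite type
  is the finitely supported map sending the exponent vector of a monomial to its coefficient.
  The product of \<^typ>\<open>('v \<Rightarrow>\<^sub>0 nat) \<Rightarrow>\<^sub>0 complex\<close> is then multiplication of polynomials.
  Real polynomials are the complex ones with real coefficients. Polynomials in
  $z_1,\ldots,z_n,w_1,\ldots,w_n$ are indexed by \<^typ>\<open>'n + 'n\<close>:
  $z_i$ is the variable \<^term>\<open>Inl i\<close> and $w_i$ the variable \<^term>\<open>Inr i\<close>.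
\<close>

type_synonym 'v cpoly = "('v \<Rightarrow>\<^sub>0 nat) \<Rightarrow>\<^sub>0 complex"

definition pconst :: "complex \<Rightarrow> 'v cpoly"
  where "pconst c = Poly_Mapping.single 0 c"

definition pvar :: "'v \<Rightarrow> 'v cpoly"
  where "pvar v = Poly_Mapping.single (Poly_Mapping.single v 1) 1"

definition pmonom :: "('v \<Rightarrow>\<^sub>0 nat) \<Rightarrow> 'v cpoly"
  where "pmonom \<alpha> = Poly_Mapping.single \<alpha> 1"

definition peval :: "'v::finite cpoly \<Rightarrow> ('v \<Rightarrow> complex) \<Rightarrow> complex"
  where "peval f x =
    (\<Sum>m\<in>Poly_Mapping.keys f. Poly_Mapping.lookup f m * (\<Prod>v\<in>UNIV. x v ^ Poly_Mapping.lookup m v))"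

definition psubst :: "('v::finite \<Rightarrow> 'u cpoly) \<Rightarrow> 'v cpoly \<Rightarrow> 'u cpoly"
  where "psubst \<sigma> f =
    (\<Sum>m\<in>Poly_Mapping.keys f.
       pconst (Poly_Mapping.lookup f m) * (\<Prod>v\<in>UNIV. \<sigma> v ^ Poly_Mapping.lookup m v))"

definition real_coeffs :: "('k \<Rightarrow>\<^sub>0 complex) \<Rightarrow> bool"
  where "real_coeffs f \<longleftrightarrow> (\<forall>m. Poly_Mapping.lookup f m \<in> \<real>)"


subsection \<open>Stable polynomials\<close>

definition stable :: "'v::finite cpoly \<Rightarrow> bool"
  where "stable f \<longleftrightarrow> (\<forall>z. (\<forall>j. Im (z j) > 0) \<longrightarrow> peval f z \<noteq> 0)"

definition real_stable :: "'v::finite cpoly \<Rightarrow> bool"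
  where "real_stable f \<longleftrightarrow> stable f \<and> real_coeffs f"


subsection \<open>The Weyl algebra\<close>

definition pderiv_var :: "'v \<Rightarrow> 'v cpoly \<Rightarrow> 'v cpoly"
  where "pderiv_var i f =
    (\<Sum>m\<in>Poly_Mapping.keys f.
       Poly_Mapping.single (m - Poly_Mapping.single i 1)
         (of_nat (Poly_Mapping.lookup m i) * Poly_Mapping.lookup f m))"

text \<open>
  $\partial^\beta = \prod_i \partial_i^{\beta_i}$. The fold over the index type is
  independent of the order of the variables, see \<open>comp_fun_commute_pderiv_var_pow\<close> below.
\<close>

definition pderiv_multi :: "('v::finite \<Rightarrow>\<^sub>0 nat) \<Rightarrow> 'v cpoly \<Rightarrow> 'v cpoly"
  where "pderiv_multi \<beta> f =
    Finite_Set.fold (\<lambda>i. pderiv_var i ^^ Poly_Mapping.lookup \<beta> i) f UNIV"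

text \<open>
  The finite families $(a_{\alpha\beta})$ are the finitely supported maps on pairs of exponent
  vectors; \<open>weyl_op a\<close> is the operator $\sum a_{\alpha\beta} z^\alpha \partial^\beta$.
\<close>

type_synonym 'v weyl_coeffs = "('v \<Rightarrow>\<^sub>0 nat) \<times> ('v \<Rightarrow>\<^sub>0 nat) \<Rightarrow>\<^sub>0 complex"

definition weyl_op :: "'v::finite weyl_coeffs \<Rightarrow> 'v cpoly \<Rightarrow> 'v cpoly"
  where "weyl_op a f =
    (\<Sum>(\<alpha>, \<beta>)\<in>Poly_Mapping.keys a.
       pconst (Poly_Mapping.lookup a (\<alpha>, \<beta>)) * pmonom \<alpha> * pderiv_multi \<beta> f)"

definition weyl_complex :: "('v::finite cpoly \<Rightarrow> 'v cpoly) set"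
  where "weyl_complex = range weyl_op"

definition weyl_real :: "('v::finite cpoly \<Rightarrow> 'v cpoly) set"
  where "weyl_real = weyl_op ` {a. real_coeffs a}"

text \<open>
  An operator of the Weyl algebra determines its coefficients $a_{\alpha\beta}$
  (\<open>inj_weyl_op\<close> below), hence its symbol.
\<close>

definition weyl_coeffs_of :: "('v::finite cpoly \<Rightarrow> 'v cpoly) \<Rightarrow> 'v weyl_coeffs"
  where "weyl_coeffs_of T = (THE a. T = weyl_op a)"

definition symbol :: "('v::finite cpoly \<Rightarrow> 'v cpoly) \<Rightarrow> ('v + 'v) cpoly"
  where "symbol T =
    (\<Sum>(\<alpha>, \<beta>)\<in>Poly_Mapping.keys (weyl_coeffs_of T).
       pconst (Poly_Mapping.lookup (weyl_coeffs_of T) (\<alpha>, \<beta>)) *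
       (\<Prod>i\<in>UNIV. pvar (Inl i) ^ Poly_Mapping.lookup \<alpha> i) *
       (\<Prod>i\<in>UNIV. pvar (Inr i) ^ Poly_Mapping.lookup \<beta> i))"


subsection \<open>Stability preservers\<close>

text \<open>Stability preservers are nonzero by definition.\<close>

definition stability_preservers :: "('v::finite cpoly \<Rightarrow> 'v cpoly) set"
  where "stability_preservers =
    {T \<in> weyl_complex. T \<noteq> (\<lambda>_. 0) \<and> T ` {f. stable f} \<subseteq> {f. stable f} \<union> {0}}"

definition real_stability_preservers :: "('v::finite cpoly \<Rightarrow> 'v cpoly) set"
  where "real_stability_preservers =
    {T \<in> weyl_real. T \<noteq> (\<lambda>_. 0) \<and> T ` {f. real_stable f} \<subseteq> {f. real_stable f} \<union> {0}}"


subsection \<open>Rescaling the variables of a symbol\<close>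

text \<open>
  $F(\mu_1 z_1,\ldots,\mu_n z_n,\lambda_1 w_1,\ldots,\lambda_n w_n)$. This may be the zero
  polynomial when some scalars are $0$ (e.g. $F = z_1$ and $\mu_1 = 0$), and $0$ is not
  the symbol of a stability preserver.
\<close>

definition rescale :: "('n \<Rightarrow> real) \<Rightarrow> ('n \<Rightarrow> real) \<Rightarrow> ('n::finite + 'n) cpoly \<Rightarrow> ('n + 'n) cpoly"
  where "rescale \<mu> lam F = psubst
    (\<lambda>v. case v of Inl i \<Rightarrow> pconst (of_real (\<mu> i)) * pvar (Inl i)
                  | Inr i \<Rightarrow> pconst (of_real (lam i)) * pvar (Inr i)) F"


subsection \<open>Well-definedness of iterated derivatives and of the symbol\<close>

lemma lookup_pderiv_var:
  "Poly_Mapping.lookup (pderiv_var i f) m =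
     of_nat (Suc (Poly_Mapping.lookup m i)) * Poly_Mapping.lookup f (m + Poly_Mapping.single i 1)"
proof -
  let ?e = "Poly_Mapping.single i (1::nat)"
  have "Poly_Mapping.lookup (pderiv_var i f) m =
    (\<Sum>m'\<in>Poly_Mapping.keys f. if m' = m + ?e then
        of_nat (Poly_Mapping.lookup m' i) * Poly_Mapping.lookup f m' else 0)"
    unfolding pderiv_var_def lookup_sum
  proof (intro sum.cong refl)
    fix m' assume "m' \<in> Poly_Mapping.keys f"
    have "m' = m + ?e" if "m' - ?e = m" "Poly_Mapping.lookup m' i \<noteq> 0"
    proof (rule poly_mapping_eqI)
      fix k
      show "Poly_Mapping.lookup m' k = Poly_Mapping.lookup (m + ?e) k"
        using that by (auto simp: lookup_add lookup_minus lookup_single when_def)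
    qed
    then have "(m' - ?e = m \<and> Poly_Mapping.lookup m' i \<noteq> 0) \<longleftrightarrow>
        (m' = m + ?e \<and> Poly_Mapping.lookup m' i \<noteq> 0)"
      by (metis add_diff_cancel_right')
    then show "Poly_Mapping.lookup (Poly_Mapping.single (m' - ?e)
        (of_nat (Poly_Mapping.lookup m' i) * Poly_Mapping.lookup f m')) m =
      (if m' = m + ?e then
        of_nat (Poly_Mapping.lookup m' i) * Poly_Mapping.lookup f m' else 0)"
      unfolding lookup_single when_def by (metis mult_zero_left of_nat_0)
  qed
  also have "\<dots> = of_nat (Poly_Mapping.lookup (m + ?e) i) * Poly_Mapping.lookup f (m + ?e)"
    by (simp add: sum.delta in_keys_iff)
  finally show ?thesis by (simp add: lookup_add)
qed

lemma pderiv_var_commute: "pderiv_var i (pderiv_var j f) = pderiv_var j (pderiv_var i f)"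
  by (rule poly_mapping_eqI)
     (auto simp: lookup_pderiv_var lookup_add lookup_single when_def ac_simps)

lemma comp_fun_commute_pderiv_var_pow:
  fixes \<beta> :: "'v \<Rightarrow>\<^sub>0 nat"
  shows "comp_fun_commute (\<lambda>i. pderiv_var i ^^ Poly_Mapping.lookup \<beta> i)"
proof
  fix i j :: 'v
  have 1: "pderiv_var i ((pderiv_var j ^^ b) f) = (pderiv_var j ^^ b) (pderiv_var i f)"
    for b and f :: "'v cpoly"
    by (induction b) (auto simp: pderiv_var_commute[of i j])
  have "(pderiv_var i ^^ a) ((pderiv_var j ^^ b) f) = (pderiv_var j ^^ b) ((pderiv_var i ^^ a) f)"
    for a b and f :: "'v cpoly"
    by (induction a) (auto simp: 1)
  then show "(pderiv_var j ^^ Poly_Mapping.lookup \<beta> j) \<circ> (pderiv_var i ^^ Poly_Mapping.lookup \<beta> i) =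
    (pderiv_var i ^^ Poly_Mapping.lookup \<beta> i) \<circ> (pderiv_var j ^^ Poly_Mapping.lookup \<beta> j)"
    by (auto simp: fun_eq_iff)
qed

lemma lookup_pderiv_var_pow:
  "Poly_Mapping.lookup ((pderiv_var i ^^ b) f) m =
     pochhammer (of_nat (Suc (Poly_Mapping.lookup m i))) b *
     Poly_Mapping.lookup f (m + Poly_Mapping.single i b)"
proof (induction b arbitrary: m)
  case (Suc b)
  have shift: "m + Poly_Mapping.single i 1 + Poly_Mapping.single i b =
      m + Poly_Mapping.single i (Suc b)"
    by (rule poly_mapping_eqI) (simp add: lookup_add lookup_single when_def)
  have "Poly_Mapping.lookup ((pderiv_var i ^^ Suc b) f) m =
      of_nat (Suc (Poly_Mapping.lookup m i)) *
      (pochhammer (of_nat (Suc (Suc (Poly_Mapping.lookup m i)))) b *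
       Poly_Mapping.lookup f (m + Poly_Mapping.single i (Suc b)))"
    by (simp only: funpow.simps comp_apply lookup_pderiv_var Suc.IH shift) (simp add: lookup_add)
  then show ?case
    by (simp only: pochhammer_rec of_nat_Suc[of "Suc _"] mult.assoc add.commute)
qed simp

lemma lookup_pderiv_multi:
  "Poly_Mapping.lookup (pderiv_multi \<beta> f) m =
     (\<Prod>i\<in>UNIV. pochhammer (of_nat (Suc (Poly_Mapping.lookup m i))) (Poly_Mapping.lookup \<beta> i)) *
     Poly_Mapping.lookup f (m + \<beta>)"
proof -
  interpret comp_fun_commute "\<lambda>i. pderiv_var i ^^ Poly_Mapping.lookup \<beta> i"
    by (rule comp_fun_commute_pderiv_var_pow)
  have *: "Poly_Mapping.lookup
      (Finite_Set.fold (\<lambda>i. pderiv_var i ^^ Poly_Mapping.lookup \<beta> i) f A) m =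
     (\<Prod>i\<in>A. pochhammer (of_nat (Suc (Poly_Mapping.lookup m i))) (Poly_Mapping.lookup \<beta> i)) *
     Poly_Mapping.lookup f (m + (\<Sum>i\<in>A. Poly_Mapping.single i (Poly_Mapping.lookup \<beta> i)))"
    if "finite A" for A
    using that
  proof (induction A arbitrary: m rule: finite_induct)
    case (insert x A)
    have "(\<Prod>i\<in>A. pochhammer (of_nat (Suc (Poly_Mapping.lookup
             (m + Poly_Mapping.single x (Poly_Mapping.lookup \<beta> x)) i))) (Poly_Mapping.lookup \<beta> i)) =
          (\<Prod>i\<in>A. pochhammer (of_nat (Suc (Poly_Mapping.lookup m i)) :: complex)
             (Poly_Mapping.lookup \<beta> i))"
      by (intro prod.cong refl) (use insert.hyps in \<open>auto simp: lookup_add lookup_single when_def\<close>)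
    then show ?case
      using insert by (simp add: lookup_pderiv_var_pow add.assoc mult.assoc)
  qed simp
  have "(\<Sum>i\<in>UNIV. Poly_Mapping.single i (Poly_Mapping.lookup \<beta> i)) = \<beta>"
    by (rule poly_mapping_eqI) (simp add: lookup_sum lookup_single when_def)
  with *[of UNIV] show ?thesis by (simp add: pderiv_multi_def)
qed

lemma pconst_mult: "pconst c * Poly_Mapping.single m d = Poly_Mapping.single m (c * d)"
  by (simp add: pconst_def mult_single)

lemma weyl_op_superset:
  assumes "finite S" "Poly_Mapping.keys a \<subseteq> S"
  shows "weyl_op a f = (\<Sum>k\<in>S. pconst (Poly_Mapping.lookup a k) * pmonom (fst k) * pderiv_multi (snd k) f)"
  unfolding weyl_op_def case_prod_beta
  by (rule sum.mono_neutral_cong_left) (use assms in \<open>auto simp: in_keys_iff pconst_def\<close>)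

lemma inj_weyl_op: "inj (weyl_op :: 'v::finite weyl_coeffs \<Rightarrow> _)"
proof (rule injI, rule ccontr)
  fix a b :: "'v weyl_coeffs"
  assume eq: "weyl_op a = weyl_op b" and "a \<noteq> b"
  define c where "c = a - b"
  have "c \<noteq> 0" using \<open>a \<noteq> b\<close> by (simp add: c_def)
  have zero: "weyl_op c f = 0" for f
  proof -
    let ?S = "Poly_Mapping.keys a \<union> Poly_Mapping.keys b"
    have sub: "Poly_Mapping.keys c \<subseteq> ?S"
      by (auto simp: c_def in_keys_iff lookup_minus)
    have "weyl_op c f = weyl_op a f - weyl_op b f"
      by (subst (1 2 3) weyl_op_superset[of ?S])
         (use sub in \<open>auto simp: c_def lookup_minus pconst_def single_diff algebra_simps
            simp flip: sum_subtractf\<close>)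
    then show ?thesis using eq by simp
  qed
  define deg :: "('v \<Rightarrow>\<^sub>0 nat) \<times> ('v \<Rightarrow>\<^sub>0 nat) \<Rightarrow> nat"
    where "deg k = (\<Sum>i\<in>UNIV. Poly_Mapping.lookup (snd k) i)" for k
  obtain k where k: "k \<in> Poly_Mapping.keys c" "\<And>k'. k' \<in> Poly_Mapping.keys c \<Longrightarrow> deg k \<le> deg k'"
    using ex_has_least_nat[of "\<lambda>k. k \<in> Poly_Mapping.keys c"] \<open>c \<noteq> 0\<close>
    by (metis ex_in_conv keys_eq_empty)
  obtain \<alpha> \<beta> where ab: "k = (\<alpha>, \<beta>)" by force
  define C :: complex where "C = (\<Prod>i\<in>UNIV. pochhammer 1 (Poly_Mapping.lookup \<beta> i))"
  have C: "C \<noteq> 0" by (simp add: C_def pochhammer_fact[symmetric])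
  have D: "pderiv_multi (snd k') (pmonom \<beta>) = (if snd k' = \<beta> then pconst C else 0)"
    if k': "k' \<in> Poly_Mapping.keys c" for k'
  proof (rule poly_mapping_eqI)
    fix m
    have *: "snd k' = \<beta> \<and> m = 0" if "\<beta> = m + snd k'"
    proof -
      have "deg k = (\<Sum>i\<in>UNIV. Poly_Mapping.lookup m i) + deg k'"
        using that by (simp add: deg_def ab lookup_add sum.distrib)
      then have "(\<Sum>i\<in>UNIV. Poly_Mapping.lookup m i) = 0" using k(2)[OF k'] by simp
      then have "m = 0" by (intro poly_mapping_eqI) simp
      with that show ?thesis by simp
    qed
    show "Poly_Mapping.lookup (pderiv_multi (snd k') (pmonom \<beta>)) m =
      Poly_Mapping.lookup (if snd k' = \<beta> then pconst C else 0) m"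
      using * by (auto simp: lookup_pderiv_multi pmonom_def pconst_def lookup_single when_def C_def)
  qed
  have "0 = Poly_Mapping.lookup (weyl_op c (pmonom \<beta>)) \<alpha>" by (simp add: zero)
  also have "\<dots> = (\<Sum>k'\<in>Poly_Mapping.keys c. if k' = k then Poly_Mapping.lookup c k * C else 0)"
    unfolding weyl_op_def case_prod_beta lookup_sum
  proof (intro sum.cong refl)
    fix k' assume "k' \<in> Poly_Mapping.keys c"
    note D = D[OF this]
    show "Poly_Mapping.lookup (pconst (Poly_Mapping.lookup c (fst k', snd k')) *
        pmonom (fst k') * pderiv_multi (snd k') (pmonom \<beta>)) \<alpha> =
      (if k' = k then Poly_Mapping.lookup c k * C else 0)"
      unfolding D
      by (cases k') (auto simp: ab pconst_def pmonom_def mult_single lookup_single when_def)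
  qed
  also have "\<dots> = Poly_Mapping.lookup c k * C" using k(1) by simp
  finally show False using C k(1) by (simp add: in_keys_iff)
qed

lemma weyl_coeffs_of_weyl_op [simp]: "weyl_coeffs_of (weyl_op a) = a"
  unfolding weyl_coeffs_of_def using inj_weyl_op by (auto dest: injD)

end

theory Submission
  imports Defs "HOL-Complex_Analysis.Complex_Analysis"
    "HOL-Computational_Algebra.Fundamental_Theorem_Algebra"
begin

text \<open>
  Let \<open>T\<close> be a preserver with symbol \<open>F(z, w)\<close> and \<open>f\<close> a stable polynomial. The operator with symbol
  \<open>F(\<mu>z, lam w)\<close> maps \<open>f\<close> to a polynomial whose value at \<open>y\<close> is obtained by applying \<open>T\<close> to
  \<open>h(x) = f(lam x + (1 - lam \<mu>) y)\<close> and setting \<open>x = \<mu>y\<close>. As \<open>h\<close> is stable for \<open>y\<close> in the upper half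
  space, \<open>T h\<close> is stable or zero; no classification of preservers is needed. To exclude \<open>T h = 0\<close>,
  \<open>f\<close> is first multiplied by \<open>\<Prod>(1 + s x\<^sub>v)\<close> to suitable powers, which places its leading
  monomial where the leading coefficient of \<open>T\<close> does not vanish, and \<open>s\<close> tends to \<open>0\<close> by Hurwitz's
  theorem. In the real case \<open>h = A + \<i> B\<close> is not real, but all real combinations of \<open>A\<close> and \<open>B\<close>
  are real stable. Hence \<open>T A / T B\<close> is never real on the upper half space, and a comparison of
  leading terms shows that it takes values in the upper half plane, so \<open>T A + \<i> T B\<close> has no zeros.
\<close>

text \<open>The polynomial h depends on the point y, so T h = 0 for a single y would already produce
  a zero of the new image there. Nonvanishing is needed for all y at once, and a leading term
  provides it: for generic weights the substitution multiplies the leading coefficient of f by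
  lam^m, whatever y is, and T multiplies the leading monomial by a polynomial in its exponent, which
  is nonzero at suitable large exponents. The scalars are first kept in the open interval (0,1), so
  that h is shifted strictly into the upper half space and lam^m is nonzero; boundary scalars are
  reached in the same limit s -> 0. In the real case, a real combination of A and B can vanish at x
  only if |A + iB| = |A - iB| there. Stability of f gives only a weak inequality between the two;
  the factors 1 + s x_v also make it strict. Exactly one variable j has weight 1. Then B has leading
  exponent m with its j-th entry lowered by one, and T A / T B grows like x_j times a positive
  constant, which has positive imaginary part for x_j on the positive imaginary axis.\<close>

abbreviation coef :: "('k \<Rightarrow>\<^sub>0 'c::zero) \<Rightarrow> 'k \<Rightarrow> 'c"
  where "coef \<equiv> Poly_Mapping.lookup"

abbreviation supp :: "('k \<Rightarrow>\<^sub>0 'c::zero) \<Rightarrow> 'k set"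
  where "supp \<equiv> Poly_Mapping.keys"

subsection \<open>Evaluation\<close>

definition mpow :: "('v::finite \<Rightarrow> 'a::comm_monoid_mult) \<Rightarrow> ('v \<Rightarrow>\<^sub>0 nat) \<Rightarrow> 'a"
  where "mpow x m = (\<Prod>v\<in>UNIV. x v ^ coef m v)"

lemma mpow_0 [simp]: "mpow x 0 = 1"
  by (simp add: mpow_def)

lemma mpow_add: "mpow x (m + m') = mpow x m * mpow x m'"
  by (simp add: mpow_def lookup_add power_add prod.distrib)

lemma mpow_single: "mpow x (Poly_Mapping.single v n) = x v ^ n"
proof -
  have "mpow x (Poly_Mapping.single v n) = (\<Prod>u\<in>UNIV. if u = v then x u ^ n else 1)"
    unfolding mpow_def by (intro prod.cong refl) (auto simp: lookup_single when_def)
  then show ?thesis by simp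
qed

lemma mpow_nonzero:
  fixes x :: "'v::finite \<Rightarrow> 'a::field"
  shows "(\<And>v. x v \<noteq> 0) \<Longrightarrow> mpow x m \<noteq> 0"
  by (simp add: mpow_def)

lemma mpow_mult: "mpow (\<lambda>v. x v * y v) m = mpow x m * mpow y m"
  by (simp add: mpow_def power_mult_distrib prod.distrib)

lemma peval_mpow: "peval f x = (\<Sum>m\<in>supp f. coef f m * mpow x m)"
  by (simp add: peval_def mpow_def)

lemma peval_superset:
  assumes "finite S" "supp f \<subseteq> S"
  shows "peval f x = (\<Sum>m\<in>S. coef f m * mpow x m)"
  unfolding peval_mpow
  by (rule sum.mono_neutral_left) (use assms in \<open>auto simp: in_keys_iff\<close>)

lemma peval_0 [simp]: "peval 0 x = 0"
  by (simp add: peval_mpow)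

lemma peval_add: "peval (f + g) x = peval f x + peval g x"
proof -
  have "supp (f + g) \<subseteq> supp f \<union> supp g" by (rule keys_add)
  then show ?thesis
    by (subst (1 2 3) peval_superset[of "supp f \<union> supp g"])
       (auto simp: lookup_add algebra_simps sum.distrib)
qed

lemma peval_sum: "peval (\<Sum>i\<in>A. f i) x = (\<Sum>i\<in>A. peval (f i) x)"
  by (induction A rule: infinite_finite_induct) (auto simp: peval_add)

lemma peval_single: "peval (Poly_Mapping.single m c) x = c * mpow x m"
  by (subst peval_superset[of "{m}"]) auto

lemma peval_pconst [simp]: "peval (pconst c) x = c"
  by (simp add: pconst_def peval_single)

lemma peval_pvar [simp]: "peval (pvar v) x = x v"
  by (simp add: pvar_def peval_single mpow_single)

lemma peval_pmonom [simp]: "peval (pmonom m) x = mpow x m"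
  by (simp add: pmonom_def peval_single)

lemma sum_monomials: "f = (\<Sum>m\<in>supp f. Poly_Mapping.single m (coef f m))"
  by (rule poly_mapping_eqI) (auto simp: lookup_sum lookup_single when_def in_keys_iff)

lemma mult_monomials:
  fixes f g :: "'v cpoly"
  shows "f * g = (\<Sum>m\<in>supp f. \<Sum>m'\<in>supp g. Poly_Mapping.single (m + m') (coef f m * coef g m'))"
  by (subst sum_monomials[of f], subst sum_monomials[of g]) (simp add: sum_product mult_single)

text \<open>The index sets may exceed the supports, so that in a limit of products the sum runs over
  a set independent of the sequence index.\<close>

lemma coef_mult:
  fixes f g :: "'v cpoly"
  assumes "finite A" "finite B" "supp f \<subseteq> A" "supp g \<subseteq> B"
  shows "coef (f * g) k = (\<Sum>m\<in>A. \<Sum>m'\<in>B. if m + m' = k then coef f m * coef g m' else 0)"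
proof -
  have "coef (f * g) k = (\<Sum>m\<in>supp f. \<Sum>m'\<in>supp g. if m + m' = k then coef f m * coef g m' else 0)"
    by (simp add: mult_monomials[of f g] lookup_sum lookup_single when_def)
  also have "\<dots> = (\<Sum>m\<in>supp f. \<Sum>m'\<in>B. if m + m' = k then coef f m * coef g m' else 0)"
    by (intro sum.cong refl sum.mono_neutral_left) (use assms in \<open>auto simp: in_keys_iff\<close>)
  also have "\<dots> = (\<Sum>m\<in>A. \<Sum>m'\<in>B. if m + m' = k then coef f m * coef g m' else 0)"
    by (intro sum.mono_neutral_left ballI sum.neutral) (use assms in \<open>auto simp: in_keys_iff\<close>)
  finally show ?thesis .
qed

lemma coef_pconst_mult: "coef (pconst c * f) m = c * coef f m"
proof -
  have "coef (pconst c * f) m =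
    (\<Sum>m1\<in>{0}. \<Sum>m'\<in>supp f. if m1 + m' = m then coef (pconst c) m1 * coef f m' else 0)"
    by (rule coef_mult) (auto simp: pconst_def)
  then show ?thesis by (simp add: pconst_def in_keys_iff)
qed

lemma peval_mult: "peval (f * g) x = peval f x * peval g x"
  by (simp add: mult_monomials[of f g] peval_sum peval_single mpow_add peval_mpow[of f x]
      peval_mpow[of g x] sum_product algebra_simps)

lemma peval_1 [simp]: "peval 1 x = 1"
  using peval_pconst[of 1 x] by (simp add: pconst_def)

lemma peval_power: "peval (f ^ n) x = peval f x ^ n"
  by (induction n) (auto simp: peval_mult)

lemma peval_prod: "peval (\<Prod>i\<in>A. f i) x = (\<Prod>i\<in>A. peval (f i) x)"
  by (induction A rule: infinite_finite_induct) (auto simp: peval_mult)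

lemma continuous_on_peval:
  assumes "\<And>v. continuous_on S (\<lambda>t. x t v)"
  shows "continuous_on S (\<lambda>t. peval f (x t))"
  unfolding peval_mpow mpow_def by (intro continuous_intros assms)

text \<open>Identifying formal with analytic partial derivatives makes the chain rule available for
  affine substitutions, with no computation on coefficients.\<close>

lemma has_field_derivative_peval:
  "((\<lambda>t. peval f (x(i := t))) has_field_derivative peval (pderiv_var i f) x) (at (x i))"
proof -
  have 1: "((\<lambda>t. mpow (x(i := t)) m) has_field_derivative
      of_nat (coef m i) * mpow x (m - Poly_Mapping.single i 1)) (at (x i))" for m
  proof -
    have eq: "mpow (x(i := t)) m = t ^ coef m i * (\<Prod>v\<in>-{i}. x v ^ coef m v)" for t
    proof -
      have "mpow (x(i := t)) m = (\<Prod>v\<in>insert i (-{i}). (x(i := t)) v ^ coef m v)"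
        unfolding mpow_def by (rule prod.cong) auto
      also have "\<dots> = t ^ coef m i * (\<Prod>v\<in>-{i}. (x(i := t)) v ^ coef m v)"
        by (subst prod.insert) auto
      also have "(\<Prod>v\<in>-{i}. (x(i := t)) v ^ coef m v) = (\<Prod>v\<in>-{i}. x v ^ coef m v)"
        by (rule prod.cong) auto
      finally show ?thesis .
    qed
    \<comment> \<open>The truncated difference is harmless: if x_i does not occur in the monomial,
      the factor \<open>of_nat (coef m i)\<close> is zero.\<close>
    have eq': "mpow x (m - Poly_Mapping.single i 1) =
        x i ^ (coef m i - 1) * (\<Prod>v\<in>-{i}. x v ^ coef m v)"
    proof -
      have "mpow x (m - Poly_Mapping.single i 1) =
          (\<Prod>v\<in>insert i (-{i}). x v ^ coef (m - Poly_Mapping.single i 1) v)"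
        unfolding mpow_def by (rule prod.cong) auto
      also have "\<dots> = x i ^ (coef m i - 1) *
          (\<Prod>v\<in>-{i}. x v ^ coef (m - Poly_Mapping.single i 1) v)"
        by (subst prod.insert) (auto simp: lookup_minus)
      also have "(\<Prod>v\<in>-{i}. x v ^ coef (m - Poly_Mapping.single i 1) v) =
          (\<Prod>v\<in>-{i}. x v ^ coef m v)"
        by (rule prod.cong) (auto simp: lookup_minus lookup_single when_def)
      finally show ?thesis .
    qed
    show ?thesis unfolding eq eq'
      by (auto intro!: derivative_eq_intros)
  qed
  have "peval (pderiv_var i f) x =
      (\<Sum>m\<in>supp f. coef f m * (of_nat (coef m i) * mpow x (m - Poly_Mapping.single i 1)))"
    by (simp add: pderiv_var_def peval_sum peval_single algebra_simps)
  then show ?thesis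
    unfolding peval_mpow[of f] by (auto intro!: derivative_eq_intros 1 sum.cong)
qed

lemma peval_pderiv_multi_affine:
  fixes f g :: "'v::finite cpoly" and c y :: "'v \<Rightarrow> complex"
  assumes "\<And>x. peval f x = peval g (\<lambda>v. c v * x v + y v)"
  shows "peval (pderiv_multi \<beta> f) x = mpow c \<beta> * peval (pderiv_multi \<beta> g) (\<lambda>v. c v * x v + y v)"
proof -
  interpret comp_fun_commute "\<lambda>i. pderiv_var i ^^ coef \<beta> i :: 'v cpoly \<Rightarrow> _"
    by (rule comp_fun_commute_pderiv_var_pow)
  \<comment> \<open>The scalar \<open>d\<close> collects the factors of the derivatives already
    taken, which makes the one-step chain rule iterable.\<close>
  have one: "peval (pderiv_var i p) x = d * c i * peval (pderiv_var i q) (\<lambda>v. c v * x v + y v)"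
    if "\<And>x. peval p x = d * peval q (\<lambda>v. c v * x v + y v)" for p q :: "'v cpoly" and d i x
  proof -
    let ?z = "\<lambda>v. c v * x v + y v"
    have "((\<lambda>s. peval q (?z(i := s))) has_field_derivative peval (pderiv_var i q) ?z) (at (?z i))"
      by (rule has_field_derivative_peval)
    moreover have "((\<lambda>t. c i * t + y i) has_field_derivative c i) (at (x i))"
      by (auto intro!: derivative_eq_intros)
    ultimately have "((\<lambda>t. peval q (?z(i := c i * t + y i))) has_field_derivative
        peval (pderiv_var i q) ?z * c i) (at (x i))"
      using DERIV_chain2[of "\<lambda>s. peval q (?z(i := s))" _ "\<lambda>t. c i * t + y i" "x i"] by simp
    then have "((\<lambda>t. d * peval q (?z(i := c i * t + y i))) has_field_derivative
        d * (peval (pderiv_var i q) ?z * c i)) (at (x i))"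
      by (rule DERIV_cmult)
    moreover have "d * peval q (?z(i := c i * t + y i)) = peval p (x(i := t))" for t
    proof -
      have "?z(i := c i * t + y i) = (\<lambda>v. c v * (x(i := t)) v + y v)" by auto
      then show ?thesis using that[of "x(i := t)"] by simp
    qed
    ultimately have "((\<lambda>t. peval p (x(i := t))) has_field_derivative
        d * (peval (pderiv_var i q) ?z * c i)) (at (x i))" by simp
    from DERIV_unique[OF has_field_derivative_peval this] show ?thesis by simp
  qed
  have pow: "peval ((pderiv_var i ^^ b) p) x =
      d * c i ^ b * peval ((pderiv_var i ^^ b) q) (\<lambda>v. c v * x v + y v)"
    if "\<And>x. peval p x = d * peval q (\<lambda>v. c v * x v + y v)" for p q :: "'v cpoly" and d i x b
  proof (induction b arbitrary: x)
    case (Suc b)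
    have "peval (pderiv_var i ((pderiv_var i ^^ b) p)) x = (d * c i ^ b) * c i *
      peval (pderiv_var i ((pderiv_var i ^^ b) q)) (\<lambda>v. c v * x v + y v)"
      by (rule one) (rule Suc)
    then show ?case by (simp add: mult_ac)
  qed (simp add: that)
  have "\<forall>x. peval (Finite_Set.fold (\<lambda>i. pderiv_var i ^^ coef \<beta> i) f A) x =
     (\<Prod>i\<in>A. c i ^ coef \<beta> i) *
      peval (Finite_Set.fold (\<lambda>i. pderiv_var i ^^ coef \<beta> i) g A) (\<lambda>v. c v * x v + y v)"
    if "finite A" for A
    using that
  proof (induction A rule: finite_induct)
    case (insert i A)
    show ?case
    proof
      fix x
      from pow[of "Finite_Set.fold (\<lambda>i. pderiv_var i ^^ coef \<beta> i) f A",
          OF insert.IH[rule_format], where i = i and b = "coef \<beta> i" and x = x]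
      show "peval (Finite_Set.fold (\<lambda>i. pderiv_var i ^^ coef \<beta> i) f (insert i A)) x =
        (\<Prod>i\<in>insert i A. c i ^ coef \<beta> i) *
        peval (Finite_Set.fold (\<lambda>i. pderiv_var i ^^ coef \<beta> i) g (insert i A)) (\<lambda>v. c v * x v + y v)"
        using insert.hyps by (simp add: mult_ac)
    qed
  qed (simp add: assms)
  from this[of UNIV] show ?thesis by (simp add: pderiv_multi_def mpow_def)
qed

lemma peval_weyl_op:
  "peval (weyl_op a f) x = (\<Sum>k\<in>supp a. coef a k * mpow x (fst k) * peval (pderiv_multi (snd k) f) x)"
  by (simp add: weyl_op_def peval_sum peval_mult case_prod_beta)

subsection \<open>Separating weights and leading terms\<close>

lemma ex_maximizer:
  fixes E :: "'a \<Rightarrow> 'b::linorder"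
  assumes "finite S" "S \<noteq> {}"
  shows "\<exists>m\<in>S. \<forall>m'\<in>S. E m' \<le> E m"
proof -
  have "Max (E ` S) \<in> E ` S" using assms by (intro Max_in) auto
  then obtain m where "m \<in> S" "E m = Max (E ` S)" by auto
  with assms show ?thesis by (metis Max_ge finite_imageI imageI)
qed

definition wdeg :: "('v::finite \<Rightarrow> nat) \<Rightarrow> ('v \<Rightarrow>\<^sub>0 nat) \<Rightarrow> nat"
  where "wdeg w m = (\<Sum>v\<in>UNIV. w v * coef m v)"

lemma wdeg_add: "wdeg w (m + m') = wdeg w m + wdeg w m'"
  by (simp add: wdeg_def lookup_add algebra_simps sum.distrib)

lemma wdeg_single: "wdeg w (Poly_Mapping.single v n) = w v * n"
proof -
  have "wdeg w (Poly_Mapping.single v n) = (\<Sum>u\<in>UNIV. if u = v then w u * n else 0)"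
    unfolding wdeg_def by (intro sum.cong refl) (auto simp: lookup_single when_def)
  then show ?thesis by simp
qed

text \<open>A bound is unavoidable: in two or more variables no natural weights separate all
  exponent vectors. \<open>L\<close> bounds those that occur.\<close>

definition separating :: "nat \<Rightarrow> ('v::finite \<Rightarrow> nat) \<Rightarrow> bool"
  where "separating L w \<longleftrightarrow> (\<forall>m m'. (\<forall>v. coef m v \<le> L \<and> coef m' v \<le> L) \<longrightarrow>
    wdeg w m = wdeg w m' \<longrightarrow> m = m')"

text \<open>The weights are the powers of a base exceeding \<open>L\<close>, so that \<open>wdeg w m\<close> has the
  entries of \<open>m\<close> as its digits.\<close>

lemma ex_separating:
  "\<exists>(w :: 'v::finite \<Rightarrow> nat) j. separating L w \<and> w j = 1 \<and> (\<forall>v. v \<noteq> j \<longrightarrow> w v \<ge> 2)"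
proof -
  obtain idx :: "'v \<Rightarrow> nat" where idx: "bij_betw idx UNIV {0..<CARD('v)}"
    using ex_bij_betw_finite_nat[of "UNIV :: 'v set"] by auto
  \<comment> \<open>A base above \<open>L\<close> suffices to separate; \<open>L + 2\<close> is also
    at least 2 when \<open>L\<close> is 0, so every variable but the one of index 0 gets weight at
    least 2.\<close>
  define B where "B = L + 2"
  define w where "w v = B ^ idx v" for v
  have inj: "idx u = idx v \<Longrightarrow> u = v" for u v
    using idx by (auto simp: bij_betw_def inj_on_def)
  have "0 \<in> idx ` UNIV" using idx by (auto simp: bij_betw_def)
  then obtain j where j: "idx j = 0" by auto
  have "w v \<ge> 2" if "v \<noteq> j" for v
  proof -
    have "idx v \<noteq> 0" using that inj j by metis
    then have "B ^ 1 \<le> B ^ idx v" by (intro power_increasing) (auto simp: B_def)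
    then show ?thesis by (simp add: w_def B_def)
  qed
  moreover have "m = m'"
    if le: "\<forall>v. coef m v \<le> L \<and> coef m' v \<le> L" and eq: "wdeg w m = wdeg w m'" for m m'
  proof (rule ccontr)
    assume "m \<noteq> m'"
    then obtain i0 where "coef m i0 \<noteq> coef m' i0" by (auto simp: poly_mapping_eq_iff fun_eq_iff)
    \<comment> \<open>At the lowest digit where m and m' differ, all other differences contribute
      multiples of B^(idx i + 1). So B divides a nonzero integer of modulus at most
      \<open>L\<close>.\<close>
    then obtain i where i: "coef m i \<noteq> coef m' i"
      and min: "\<And>v. coef m v \<noteq> coef m' v \<Longrightarrow> idx i \<le> idx v"
      using ex_has_least_nat[of "\<lambda>v. coef m v \<noteq> coef m' v" i0 idx] by auto
    define d where "d v = int (coef m v) - int (coef m' v)" for v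
    have "(\<Sum>v\<in>UNIV. int B ^ idx v * d v) = int (wdeg w m) - int (wdeg w m')"
      by (simp add: wdeg_def w_def d_def algebra_simps sum_subtractf)
    then have "0 = (\<Sum>v\<in>UNIV. int B ^ idx v * d v)" by (simp add: eq)
    also have "\<dots> = int B ^ idx i * d i + (\<Sum>v\<in>UNIV - {i}. int B ^ idx v * d v)"
      by (rule sum.remove) auto
    finally have "int B ^ idx i * d i = - (\<Sum>v\<in>UNIV - {i}. int B ^ idx v * d v)" by simp
    moreover have "int B ^ Suc (idx i) dvd (\<Sum>v\<in>UNIV - {i}. int B ^ idx v * d v)"
    proof (rule dvd_sum)
      fix v assume v: "v \<in> UNIV - {i}"
      show "int B ^ Suc (idx i) dvd int B ^ idx v * d v"
      proof (cases "d v = 0")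
        case False
        then have "idx i \<le> idx v" by (intro min) (auto simp: d_def)
        with v inj have "Suc (idx i) \<le> idx v" by (metis DiffD2 insertI1 le_antisym not_less_eq_eq)
        then show ?thesis by (intro dvd_mult2 le_imp_power_dvd)
      qed auto
    qed
    ultimately have "int B ^ Suc (idx i) dvd int B ^ idx i * d i" by simp
    then have "int B dvd d i" by (simp add: B_def)
    moreover have "d i \<noteq> 0" using i by (simp add: d_def)
    ultimately have "int B \<le> \<bar>d i\<bar>" using dvd_imp_le_int[of "d i" "int B"] by simp
    moreover have "\<bar>d i\<bar> \<le> int L"
      using le[rule_format, of i] by (auto simp: d_def)
    ultimately show False by (simp add: B_def)
  qed
  then have "separating L w" unfolding separating_def by blast
  moreover have "w j = 1" by (simp add: w_def j)
  ultimately show ?thesis by blast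
qed

lemma ex_coef_bound:
  fixes S :: "('v::finite \<Rightarrow>\<^sub>0 nat) set"
  assumes "finite S"
  shows "\<exists>L. \<forall>m\<in>S. \<forall>v. coef m v \<le> L"
proof -
  have "finite ((\<lambda>(m, v). coef m v) ` (S \<times> (UNIV :: 'v set)))" using assms by simp
  then obtain L where "\<forall>n\<in>(\<lambda>(m, v). coef m v) ` (S \<times> (UNIV :: 'v set)). n \<le> L"
    using finite_nat_set_iff_bounded_le by metis
  then show ?thesis by (intro exI[of _ L]) auto
qed

section \<open>Asymptotics on curves in the upper half space\<close>

definition ray :: "('v \<Rightarrow> nat) \<Rightarrow> real \<Rightarrow> 'v \<Rightarrow> complex"
  where "ray w \<rho> v = \<i> * of_real (\<rho> ^ w v)"

lemma Im_ray_pos: "\<rho> > 0 \<Longrightarrow> Im (ray w \<rho> v) > 0"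
  by (simp add: ray_def)

lemma ray_nonzero: "\<rho> > 0 \<Longrightarrow> ray w \<rho> v \<noteq> 0"
  by (simp add: ray_def)

text \<open>The weighted degree is therefore the growth order of a monomial on the curve, and the
  curve stays where stable polynomials do not vanish.\<close>

lemma norm_mpow_ray: "\<rho> > 0 \<Longrightarrow> norm (mpow (ray w \<rho>) m) = \<rho> ^ wdeg w m"
  by (simp add: mpow_def ray_def wdeg_def norm_mult norm_power power_sum power_mult prod_norm[symmetric])

lemma ray_ratio_tendsto_0:
  assumes "wdeg w p < wdeg w q"
  shows "((\<lambda>\<rho>. mpow (ray w \<rho>) p / mpow (ray w \<rho>) q) \<longlongrightarrow> 0) at_top"
proof (rule tendsto_norm_zero_cancel)
  have "((\<lambda>\<rho>::real. inverse (\<rho> ^ (wdeg w q - wdeg w p))) \<longlongrightarrow> 0) at_top"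
    using assms by (intro tendsto_inverse_0_at_top filterlim_pow_at_top filterlim_ident) auto
  moreover have "eventually (\<lambda>\<rho>. inverse (\<rho> ^ (wdeg w q - wdeg w p)) =
      norm (mpow (ray w \<rho>) p / mpow (ray w \<rho>) q)) at_top"
    using eventually_gt_at_top[of "0::real"]
  proof eventually_elim
    case (elim \<rho>)
    then show ?case using assms
      by (simp add: norm_divide norm_mpow_ray power_diff field_simps)
  qed
  ultimately show "((\<lambda>\<rho>. norm (mpow (ray w \<rho>) p / mpow (ray w \<rho>) q)) \<longlongrightarrow> 0) at_top"
    by (rule Lim_transform_eventually)
qed

text \<open>The exponent m need not lie in the support. The property thus passes to real parts and
  affine images before the coefficient at m is known.\<close>

definition lead :: "('v::finite \<Rightarrow> nat) \<Rightarrow> ('v \<Rightarrow>\<^sub>0 nat) \<Rightarrow> 'v cpoly \<Rightarrow> bool"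
  where "lead w m f \<longleftrightarrow> (\<forall>m'\<in>supp f. m' \<noteq> m \<longrightarrow> wdeg w m' < wdeg w m)"

text \<open>The factors \<open>s\<close> weight each monomial separately: constant 1 yields the
  leading term of f itself, normalised multipliers of a Weyl operator yield that of its
  image.\<close>

lemma lead_tendsto:
  assumes "lead w m f" "\<And>m. ((s m) \<longlongrightarrow> S m) at_top"
  shows "((\<lambda>\<rho>. (\<Sum>m'\<in>supp f. coef f m' * mpow (ray w \<rho>) m' * s m' \<rho>) / mpow (ray w \<rho>) m)
    \<longlongrightarrow> coef f m * S m) at_top"
proof -
  have "((\<lambda>\<rho>. \<Sum>m'\<in>supp f. coef f m' * (mpow (ray w \<rho>) m' / mpow (ray w \<rho>) m) * s m' \<rho>)
    \<longlongrightarrow> (\<Sum>m'\<in>supp f. if m' = m then coef f m * S m else 0)) at_top"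
  proof (rule tendsto_sum)
    fix m' assume m': "m' \<in> supp f"
    show "((\<lambda>\<rho>. coef f m' * (mpow (ray w \<rho>) m' / mpow (ray w \<rho>) m) * s m' \<rho>)
      \<longlongrightarrow> (if m' = m then coef f m * S m else 0)) at_top"
    proof (cases "m' = m")
      case True
      have "((\<lambda>\<rho>. coef f m * s m \<rho>) \<longlongrightarrow> coef f m * S m) at_top"
        by (intro tendsto_intros assms)
      moreover have "eventually (\<lambda>\<rho>. coef f m * s m \<rho> =
          coef f m' * (mpow (ray w \<rho>) m' / mpow (ray w \<rho>) m) * s m' \<rho>) at_top"
        using eventually_gt_at_top[of "0::real"]
        by eventually_elim (simp add: True mpow_nonzero ray_nonzero)
      ultimately have "((\<lambda>\<rho>. coef f m' * (mpow (ray w \<rho>) m' / mpow (ray w \<rho>) m) * s m' \<rho>)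
          \<longlongrightarrow> coef f m * S m) at_top"
        by (rule Lim_transform_eventually)
      then show ?thesis using True by simp
    next
      case False
      then have "wdeg w m' < wdeg w m" using assms m' by (auto simp: lead_def)
      then have "((\<lambda>\<rho>. coef f m' * (mpow (ray w \<rho>) m' / mpow (ray w \<rho>) m) * s m' \<rho>)
          \<longlongrightarrow> coef f m' * 0 * S m') at_top"
        by (intro tendsto_intros assms ray_ratio_tendsto_0)
      then show ?thesis using False by simp
    qed
  qed
  moreover have "(\<Sum>m'\<in>supp f. if m' = m then coef f m * S m else 0) = coef f m * S m"
    by (auto simp: in_keys_iff)
  ultimately show ?thesis by (simp add: sum_divide_distrib)
qed

lemma ex_lead:
  fixes f :: "'v::finite cpoly"
  assumes "separating L w" "\<And>m v. m \<in> supp f \<Longrightarrow> coef m v \<le> L" "f \<noteq> 0"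
  obtains m where "m \<in> supp f" "lead w m f"
proof -
  have "finite (supp f)" "supp f \<noteq> {}" using assms(3) by auto
  then obtain m where m: "m \<in> supp f" "\<And>m'. m' \<in> supp f \<Longrightarrow> wdeg w m' \<le> wdeg w m"
    using ex_maximizer[of "supp f" "wdeg w"] by blast
  have "lead w m f"
    unfolding lead_def
  proof (intro ballI impI)
    fix m' assume "m' \<in> supp f" "m' \<noteq> m"
    with m have "wdeg w m' \<le> wdeg w m" "wdeg w m' \<noteq> wdeg w m"
      using assms(1,2) unfolding separating_def by metis+
    then show "wdeg w m' < wdeg w m" by simp
  qed
  with m that show thesis by blast
qed

text \<open>Divided by its leading monomial, f tends to a nonzero coefficient along the curve. The
  point found serves as a second point on a complex line when Hurwitz's theorem is applied.\<close>

lemma peval_nonzero_upper: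
  fixes f :: "'v::finite cpoly"
  assumes "f \<noteq> 0"
  obtains x where "\<And>v. Im (x v) > 0" "peval f x \<noteq> 0"
proof -
  obtain L where L: "\<forall>m\<in>supp f. \<forall>v. coef m v \<le> L" using ex_coef_bound[of "supp f"] by auto
  obtain w :: "'v \<Rightarrow> nat" where w: "separating L w" using ex_separating by blast
  obtain m where m: "m \<in> supp f" "lead w m f" using ex_lead[OF w _ assms] L by blast
  have "((\<lambda>\<rho>. (\<Sum>m'\<in>supp f. coef f m' * mpow (ray w \<rho>) m' * 1) / mpow (ray w \<rho>) m)
    \<longlongrightarrow> coef f m * 1) at_top"
    by (rule lead_tendsto[OF m(2), of "\<lambda>_ _. 1" "\<lambda>_. 1"]) simp
  moreover have "coef f m * 1 \<noteq> 0" using m(1) by (simp add: in_keys_iff)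
  ultimately have "eventually (\<lambda>\<rho>. (\<Sum>m'\<in>supp f. coef f m' * mpow (ray w \<rho>) m' * 1) /
      mpow (ray w \<rho>) m \<noteq> 0) at_top"
    by (rule tendsto_imp_eventually_ne)
  then have "eventually (\<lambda>\<rho>. peval f (ray w \<rho>) / mpow (ray w \<rho>) m \<noteq> 0) at_top"
    by (simp only: peval_mpow mult_1_right)
  with eventually_gt_at_top[of "0::real"]
  have "eventually (\<lambda>\<rho>. \<rho> > 0 \<and> peval f (ray w \<rho>) \<noteq> 0) at_top"
    by eventually_elim (metis div_0)
  then obtain \<rho> where "\<rho> > 0" "peval f (ray w \<rho>) \<noteq> 0"
    using eventually_happens'[OF trivial_limit_at_top_linorder] by blast
  then show thesis by (intro that[of "ray w \<rho>"] Im_ray_pos)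
qed

subsection \<open>Leading terms of Weyl operators\<close>

text \<open>The multivariate falling factorial, the coefficient of x^(m - \<beta>) in the \<beta>-th
  derivative of x^m when taken at m. Complex arguments display it as a polynomial in m.\<close>

definition ffact :: "('v::finite \<Rightarrow> complex) \<Rightarrow> ('v \<Rightarrow>\<^sub>0 nat) \<Rightarrow> complex"
  where "ffact x \<beta> = (\<Prod>v\<in>UNIV. \<Prod>l<coef \<beta> v. x v - of_nat l)"

abbreviation mffact :: "('v::finite \<Rightarrow>\<^sub>0 nat) \<Rightarrow> ('v \<Rightarrow>\<^sub>0 nat) \<Rightarrow> complex"
  where "mffact m \<equiv> ffact (\<lambda>v. of_nat (coef m v))"

text \<open>If some entry of \<beta> exceeds that of m, the falling factorial has a zero factor.
  Truncated differences m - \<beta> therefore only matter where they are genuine.\<close>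

lemma mffact_nonzero_imp:
  assumes "mffact m \<beta> \<noteq> 0"
  shows "m = (m - \<beta>) + \<beta>"
proof (rule poly_mapping_eqI)
  fix v
  have "(\<Prod>l<coef \<beta> v. complex_of_nat (coef m v) - of_nat l) \<noteq> 0"
    using assms by (auto simp: ffact_def)
  then have "coef \<beta> v \<le> coef m v" by (force simp: not_le)
  then show "coef m v = coef (m - \<beta> + \<beta>) v" by (simp add: lookup_add lookup_minus)
qed

lemma mffact_add: "mffact (k + \<beta>) \<beta> = (\<Prod>i\<in>UNIV. pochhammer (of_nat (Suc (coef k i))) (coef \<beta> i))"
  unfolding ffact_def
proof (intro prod.cong refl)
  fix i
  have "(\<Prod>l<b. complex_of_nat (n + b) - of_nat l) = pochhammer (of_nat (Suc n)) b" for n b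
  proof (induction b)
    case (Suc b)
    have "(\<Prod>l<Suc b. complex_of_nat (n + Suc b) - of_nat l) =
        of_nat (n + Suc b) * (\<Prod>l<b. complex_of_nat (n + b) - of_nat l)"
      by (subst prod.lessThan_Suc_shift) simp
    then show ?case unfolding Suc by (simp add: pochhammer_Suc algebra_simps)
  qed simp
  then show "(\<Prod>l<coef \<beta> i. complex_of_nat (coef (k + \<beta>) i) - of_nat l) =
    pochhammer (of_nat (Suc (coef k i))) (coef \<beta> i)"
    by (simp add: lookup_add)
qed

lemma pderiv_multi_monomials:
  "pderiv_multi \<beta> f = (\<Sum>m\<in>supp f. Poly_Mapping.single (m - \<beta>) (coef f m * mffact m \<beta>))"
proof (rule poly_mapping_eqI)
  fix k
  have "coef (\<Sum>m\<in>supp f. Poly_Mapping.single (m - \<beta>) (coef f m * mffact m \<beta>)) k =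
      (\<Sum>m\<in>supp f. if m = k + \<beta> then coef f m * mffact m \<beta> else 0)"
    unfolding lookup_sum lookup_single when_def
  proof (intro sum.cong refl)
    fix m
    have "m - \<beta> = k \<longleftrightarrow> m = k + \<beta>" if "mffact m \<beta> \<noteq> 0"
      using mffact_nonzero_imp[OF that] by (metis add_diff_cancel_right')
    then show "(if m - \<beta> = k then coef f m * mffact m \<beta> else 0) =
        (if m = k + \<beta> then coef f m * mffact m \<beta> else 0)"
      by auto
  qed
  also have "\<dots> = coef f (k + \<beta>) * mffact (k + \<beta>) \<beta>"
    by (auto simp: in_keys_iff)
  finally show "coef (pderiv_multi \<beta> f) k =
      coef (\<Sum>m\<in>supp f. Poly_Mapping.single (m - \<beta>) (coef f m * mffact m \<beta>)) k"
    by (simp only: lookup_pderiv_multi mffact_add mult.commute)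
qed

text \<open>The multiplier by which the operator acts on x^m away from the coordinate hyperplanes: a
  term z^\<alpha> \<partial>^\<beta> contributes a falling factorial times x^(\<alpha> -
  \<beta>).\<close>

definition wfactor :: "'v::finite weyl_coeffs \<Rightarrow> ('v \<Rightarrow>\<^sub>0 nat) \<Rightarrow> ('v \<Rightarrow> complex) \<Rightarrow> complex"
  where "wfactor a m x =
    (\<Sum>k\<in>supp a. coef a k * mffact m (snd k) * (mpow x (fst k) / mpow x (snd k)))"

lemma peval_weyl_op_wfactor:
  assumes "\<And>v. x v \<noteq> 0"
  shows "peval (weyl_op a f) x = (\<Sum>m\<in>supp f. coef f m * mpow x m * wfactor a m x)"
proof -
  have *: "peval (pderiv_multi \<beta> f) x = (\<Sum>m\<in>supp f. coef f m * mffact m \<beta> * mpow x m / mpow x \<beta>)" for \<beta>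
    unfolding pderiv_multi_monomials peval_sum peval_single
  proof (intro sum.cong refl)
    fix m
    show "coef f m * mffact m \<beta> * mpow x (m - \<beta>) = coef f m * mffact m \<beta> * mpow x m / mpow x \<beta>"
    proof (cases "mffact m \<beta> = 0")
      case False
      have "mpow x m = mpow x (m - \<beta>) * mpow x \<beta>"
        using mffact_nonzero_imp[OF False] mpow_add by metis
      then show ?thesis using mpow_nonzero[of x] assms by simp
    qed simp
  qed
  have "peval (weyl_op a f) x = (\<Sum>k\<in>supp a. \<Sum>m\<in>supp f.
      coef f m * mpow x m * (coef a k * mffact m (snd k) * (mpow x (fst k) / mpow x (snd k))))"
    by (simp add: peval_weyl_op * sum_distrib_left mult_ac)
  also have "\<dots> = (\<Sum>m\<in>supp f. coef f m * mpow x m * wfactor a m x)"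
    by (subst sum.swap) (simp add: wfactor_def sum_distrib_left)
  finally show ?thesis .
qed

text \<open>The shift \<alpha> - \<beta> may have negative entries, so shifts are compared after
  adding both second components. The pair k0 has maximal weighted shift, and every other pair has
  the same shift or one of strictly smaller weight.\<close>

definition dominant :: "('v::finite \<Rightarrow> nat) \<Rightarrow> 'v weyl_coeffs \<Rightarrow> ('v \<Rightarrow>\<^sub>0 nat) \<times> ('v \<Rightarrow>\<^sub>0 nat) \<Rightarrow> bool"
  where "dominant w a k0 \<longleftrightarrow> k0 \<in> supp a \<and>
    (\<forall>k\<in>supp a. fst k + snd k0 \<noteq> fst k0 + snd k \<longrightarrow>
       wdeg w (fst k + snd k0) < wdeg w (fst k0 + snd k))"

text \<open>Several pairs may share the dominant shift; this polynomial in the exponent collects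
  their contributions to the leading term.\<close>

definition top_factor :: "'v::finite weyl_coeffs \<Rightarrow> ('v \<Rightarrow>\<^sub>0 nat) \<times> ('v \<Rightarrow>\<^sub>0 nat) \<Rightarrow> ('v \<Rightarrow> complex) \<Rightarrow> complex"
  where "top_factor a k0 x =
    (\<Sum>k\<in>{k\<in>supp a. fst k + snd k0 = fst k0 + snd k}. coef a k * ffact x (snd k))"

text \<open>Separation up to \<open>2 * L\<close> is needed because the compared vectors are sums of
  two exponents bounded by \<open>L\<close>.\<close>

lemma ex_dominant:
  fixes a :: "'v::finite weyl_coeffs"
  assumes "separating (2 * L) w" "\<And>k v. k \<in> supp a \<Longrightarrow> coef (fst k) v \<le> L \<and> coef (snd k) v \<le> L"
    and "a \<noteq> 0"
  shows "\<exists>k0. dominant w a k0"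
proof -
  define E where "E k = int (wdeg w (fst k)) - int (wdeg w (snd k))" for k :: "('v \<Rightarrow>\<^sub>0 nat) \<times> ('v \<Rightarrow>\<^sub>0 nat)"
  have "finite (supp a)" "supp a \<noteq> {}" using assms(3) by auto
  then obtain k0 where k0: "k0 \<in> supp a" "\<And>k. k \<in> supp a \<Longrightarrow> E k \<le> E k0"
    using ex_maximizer[of "supp a" E] by blast
  have "wdeg w (fst k + snd k0) < wdeg w (fst k0 + snd k)"
    if k: "k \<in> supp a" and ne: "fst k + snd k0 \<noteq> fst k0 + snd k" for k
  proof -
    have "coef (fst k + snd k0) v \<le> 2 * L \<and> coef (fst k0 + snd k) v \<le> 2 * L" for v
      using assms(2)[OF k, of v] assms(2)[OF k0(1), of v] by (auto simp: lookup_add)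
    with ne assms(1) have "wdeg w (fst k + snd k0) \<noteq> wdeg w (fst k0 + snd k)"
      unfolding separating_def by blast
    moreover have "wdeg w (fst k + snd k0) \<le> wdeg w (fst k0 + snd k)"
      using k0(2)[OF k] by (simp add: E_def wdeg_add)
    ultimately show ?thesis by simp
  qed
  with k0 show ?thesis unfolding dominant_def by blast
qed

lemma wfactor_tendsto:
  assumes "dominant w a k0"
  shows "((\<lambda>\<rho>. wfactor a m (ray w \<rho>) / (mpow (ray w \<rho>) (fst k0) / mpow (ray w \<rho>) (snd k0)))
    \<longlongrightarrow> top_factor a k0 (\<lambda>v. of_nat (coef m v))) at_top"
proof -
  let ?c = "\<lambda>k. coef a k * mffact m (snd k)"
  let ?q = "\<lambda>k \<rho>. mpow (ray w \<rho>) (fst k + snd k0) / mpow (ray w \<rho>) (fst k0 + snd k)"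
  have "((\<lambda>\<rho>. \<Sum>k\<in>supp a. ?c k * ?q k \<rho>) \<longlongrightarrow>
      (\<Sum>k\<in>supp a. if fst k + snd k0 = fst k0 + snd k then ?c k else 0)) at_top"
  proof (rule tendsto_sum)
    fix k assume k: "k \<in> supp a"
    show "((\<lambda>\<rho>. ?c k * ?q k \<rho>) \<longlongrightarrow>
      (if fst k + snd k0 = fst k0 + snd k then ?c k else 0)) at_top"
    proof (cases "fst k + snd k0 = fst k0 + snd k")
      case True
      have "eventually (\<lambda>\<rho>. ?c k = ?c k * ?q k \<rho>) at_top"
        using eventually_gt_at_top[of "0::real"]
        by eventually_elim (simp add: True mpow_nonzero ray_nonzero)
      then have "((\<lambda>\<rho>. ?c k * ?q k \<rho>) \<longlongrightarrow> ?c k) at_top"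
        by (rule Lim_transform_eventually[OF tendsto_const])
      then show ?thesis using True by simp
    next
      case False
      then have "((\<lambda>\<rho>. ?c k * ?q k \<rho>) \<longlongrightarrow> ?c k * 0) at_top"
        using assms k by (intro tendsto_intros ray_ratio_tendsto_0) (auto simp: dominant_def)
      then show ?thesis using False by simp
    qed
  qed
  moreover have "(\<Sum>k\<in>supp a. if fst k + snd k0 = fst k0 + snd k then ?c k else 0) =
      top_factor a k0 (\<lambda>v. of_nat (coef m v))"
    unfolding top_factor_def by (rule sum.inter_filter[symmetric]) simp
  moreover have "eventually (\<lambda>\<rho>. (\<Sum>k\<in>supp a. ?c k * ?q k \<rho>) =
      wfactor a m (ray w \<rho>) / (mpow (ray w \<rho>) (fst k0) / mpow (ray w \<rho>) (snd k0))) at_top"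
    using eventually_gt_at_top[of "0::real"]
  proof eventually_elim
    case (elim \<rho>)
    show ?case unfolding wfactor_def sum_divide_distrib
      by (intro sum.cong refl) (simp add: mpow_add mult_ac)
  qed
  ultimately show ?thesis using Lim_transform_eventually by force
qed

lemma weyl_lead_tendsto:
  assumes "dominant w a k0" "lead w m f"
  shows "((\<lambda>\<rho>. peval (weyl_op a f) (ray w \<rho>) /
      (mpow (ray w \<rho>) (fst k0) / mpow (ray w \<rho>) (snd k0)) / mpow (ray w \<rho>) m)
    \<longlongrightarrow> coef f m * top_factor a k0 (\<lambda>v. of_nat (coef m v))) at_top"
proof -
  let ?X = "\<lambda>\<rho>. mpow (ray w \<rho>) (fst k0) / mpow (ray w \<rho>) (snd k0)"
  have "((\<lambda>\<rho>. (\<Sum>m'\<in>supp f. coef f m' * mpow (ray w \<rho>) m' * (wfactor a m' (ray w \<rho>) / ?X \<rho>)) /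
      mpow (ray w \<rho>) m) \<longlongrightarrow> coef f m * top_factor a k0 (\<lambda>v. of_nat (coef m v))) at_top"
    by (rule lead_tendsto[OF assms(2)]) (rule wfactor_tendsto[OF assms(1)])
  moreover have "eventually (\<lambda>\<rho>. (\<Sum>m'\<in>supp f. coef f m' * mpow (ray w \<rho>) m' * (wfactor a m' (ray w \<rho>) / ?X \<rho>)) /
      mpow (ray w \<rho>) m = peval (weyl_op a f) (ray w \<rho>) / ?X \<rho> / mpow (ray w \<rho>) m) at_top"
    using eventually_gt_at_top[of "0::real"]
  proof eventually_elim
    case (elim \<rho>)
    show ?case
      unfolding peval_weyl_op_wfactor[OF ray_nonzero[OF elim]]
      by (simp only: sum_divide_distrib times_divide_eq_right)
  qed
  ultimately show ?thesis by (rule Lim_transform_eventually)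
qed

lemma filterlim_of_nat_power:
  "n > 0 \<Longrightarrow> filterlim (\<lambda>t. of_nat t ^ n :: complex) at_infinity sequentially"
proof -
  assume "n > 0"
  then have "filterlim (\<lambda>t. real t ^ n) at_top sequentially"
    by (intro filterlim_pow_at_top filterlim_real_sequentially)
  then have "filterlim (\<lambda>t. norm (of_nat t ^ n :: complex)) at_top sequentially"
    by (simp add: norm_power)
  then show ?thesis by (rule filterlim_norm_at_top_imp_at_infinity)
qed

lemma ffact_tendsto:
  fixes x :: "nat \<Rightarrow> 'v::finite \<Rightarrow> complex"
  assumes "\<And>v. w v \<ge> 1" "\<And>v. (\<lambda>t. x t v / of_nat t ^ w v) \<longlonglongrightarrow> 1"
  shows "(\<lambda>t. ffact (x t) \<beta> / of_nat t ^ wdeg w \<beta>) \<longlonglongrightarrow> 1"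
proof -
  have "(\<lambda>t. \<Prod>v\<in>UNIV. \<Prod>l<coef \<beta> v. x t v / of_nat t ^ w v - of_nat l / of_nat t ^ w v) \<longlonglongrightarrow>
    (\<Prod>v\<in>UNIV. \<Prod>l<coef \<beta> v. 1 - 0)"
  proof (intro tendsto_prod tendsto_diff assms)
    fix v :: 'v and l :: nat
    have "filterlim (\<lambda>t. of_nat t ^ w v :: complex) at_infinity sequentially"
      using assms(1)[of v] by (intro filterlim_of_nat_power) auto
    then show "(\<lambda>t. complex_of_nat l / of_nat t ^ w v) \<longlonglongrightarrow> 0"
      by (rule tendsto_divide_0[OF tendsto_const])
  qed
  moreover have "(\<Prod>v\<in>UNIV. \<Prod>l<coef \<beta> v. x t v / of_nat t ^ w v - of_nat l / of_nat t ^ w v) =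
      ffact (x t) \<beta> / of_nat t ^ wdeg w \<beta>" for t
    by (simp add: ffact_def wdeg_def prod_dividef power_sum power_mult flip: diff_divide_distrib)
  ultimately show ?thesis by simp
qed

text \<open>A falling factorial of order \<beta> grows like t to the weighted degree of \<beta>, so
  the pair with the heaviest second component wins and its coefficient is the limit.\<close>

lemma top_factor_tendsto:
  fixes x :: "nat \<Rightarrow> 'v::finite \<Rightarrow> complex"
  assumes "\<And>v. w v \<ge> 1" "\<And>v. (\<lambda>t. x t v / of_nat t ^ w v) \<longlonglongrightarrow> 1"
    and "k1 \<in> supp a" "fst k1 + snd k0 = fst k0 + snd k1"
    and "\<And>k. k \<in> supp a \<Longrightarrow> fst k + snd k0 = fst k0 + snd k \<Longrightarrow> k \<noteq> k1 \<Longrightarrow>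
      wdeg w (snd k) < wdeg w (snd k1)"
  shows "(\<lambda>t. top_factor a k0 (x t) / of_nat t ^ wdeg w (snd k1)) \<longlonglongrightarrow> coef a k1"
proof -
  let ?K = "{k\<in>supp a. fst k + snd k0 = fst k0 + snd k}"
  have "(\<lambda>t. \<Sum>k\<in>?K. coef a k * ffact (x t) (snd k) / of_nat t ^ wdeg w (snd k1)) \<longlonglongrightarrow>
    (\<Sum>k\<in>?K. if k = k1 then coef a k1 else 0)"
  proof (rule tendsto_sum)
    fix k assume k: "k \<in> ?K"
    have ff: "(\<lambda>t. ffact (x t) (snd k) / of_nat t ^ wdeg w (snd k)) \<longlonglongrightarrow> 1"
      by (rule ffact_tendsto) (use assms in auto)
    show "(\<lambda>t. coef a k * ffact (x t) (snd k) / of_nat t ^ wdeg w (snd k1)) \<longlonglongrightarrow>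
      (if k = k1 then coef a k1 else 0)"
    proof (cases "k = k1")
      case True
      then show ?thesis using tendsto_mult[OF tendsto_const ff, of "coef a k"] by simp
    next
      case False
      define n where "n = wdeg w (snd k1) - wdeg w (snd k)"
      have n: "n > 0" "wdeg w (snd k1) = wdeg w (snd k) + n"
        using assms(5)[of k] k False by (auto simp: n_def)
      have "filterlim (\<lambda>t. of_nat t ^ n :: complex) at_infinity sequentially"
        using n by (intro filterlim_of_nat_power)
      from tendsto_divide_0[OF tendsto_mult[OF tendsto_const ff, of "coef a k"] this]
      show ?thesis using False by (simp add: n power_add)
    qed
  qed
  then show ?thesis using assms(3,4) by (simp add: top_factor_def sum_divide_distrib)
qed

lemma coef_Abs_poly_mapping [simp]: "coef (Abs_poly_mapping f) = f" for f :: "'v::finite \<Rightarrow> 'a::zero"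
  by (rule lookup_Abs_poly_mapping) simp

lemma real_ffact: "(\<And>v. x v \<in> \<real>) \<Longrightarrow> ffact x \<beta> \<in> \<real>"
  unfolding ffact_def by (intro prod_in_Reals Reals_diff) auto

text \<open>For m = (t^(w v)) with t large, the top factor is asymptotic to a nonzero coefficient
  times a power of t, and lowering one entry by 1 does not change the asymptotics. The quotient of
  the two values tends to 1, so its real part is eventually positive; for real coefficients the
  quotient is itself real.\<close>

lemma ex_good_exponent:
  fixes a :: "'v::finite weyl_coeffs" and w :: "'v \<Rightarrow> nat"
  assumes sep: "separating L w" and w: "\<And>v. w v \<ge> 1"
    and L: "\<And>k v. k \<in> supp a \<Longrightarrow> coef (snd k) v \<le> L" and k0: "k0 \<in> supp a"
  shows "\<exists>m. (\<forall>v. coef m v > coef m0 v) \<and> top_factor a k0 (\<lambda>v. of_nat (coef m v)) \<noteq> 0 \<and>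
    (real_coeffs a \<longrightarrow> (\<exists>r>0. top_factor a k0 (\<lambda>v. of_nat (coef m v)) =
       of_real r * top_factor a k0 (\<lambda>v. of_nat (coef (m - Poly_Mapping.single j 1) v))))"
proof -
  define K where "K = {k\<in>supp a. fst k + snd k0 = fst k0 + snd k}"
  have "finite K" by (simp add: K_def)
  moreover have "k0 \<in> K" using k0 by (simp add: K_def)
  then have "K \<noteq> {}" by blast
  ultimately obtain k1
    where k1: "k1 \<in> K" "\<And>k. k \<in> K \<Longrightarrow> wdeg w (snd k) \<le> wdeg w (snd k1)"
    using ex_maximizer[of K "\<lambda>k. wdeg w (snd k)"] by blast
  \<comment> \<open>All pairs in \<open>K\<close> have the same shift, so the second component
    determines the pair, and separating second components gives a unique maximum.\<close>
  have k1_max: "wdeg w (snd k) < wdeg w (snd k1)"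
    if k: "k \<in> supp a" "fst k + snd k0 = fst k0 + snd k" and ne: "k \<noteq> k1" for k
  proof -
    have "snd k \<noteq> snd k1"
    proof
      assume eq: "snd k = snd k1"
      with k k1(1) have "fst k + snd k0 = fst k1 + snd k0" by (simp add: K_def)
      then have "fst k = fst k1" by simp
      with eq ne show False by (simp add: prod_eq_iff)
    qed
    then have "wdeg w (snd k) \<noteq> wdeg w (snd k1)"
      using sep L[OF k(1)] L[of k1] k1(1) unfolding separating_def K_def by blast
    with k1(2)[of k] k show ?thesis by (simp add: K_def)
  qed
  define m :: "nat \<Rightarrow> 'v \<Rightarrow>\<^sub>0 nat" where "m t = Abs_poly_mapping (\<lambda>v. t ^ w v)" for t
  have m: "coef (m t) = (\<lambda>v. t ^ w v)" for t by (simp add: m_def)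
  let ?m' = "\<lambda>t. m t - Poly_Mapping.single j 1"
  let ?P = "\<lambda>m. top_factor a k0 (\<lambda>v. of_nat (coef m v))"
  have atinf: "filterlim (\<lambda>t. of_nat t ^ w v :: complex) at_infinity sequentially" for v
    using w[of v] by (intro filterlim_of_nat_power) auto
  have l1: "(\<lambda>t. complex_of_nat (coef (m t) v) / of_nat t ^ w v) \<longlonglongrightarrow> 1" for v
  proof (rule Lim_transform_eventually[OF tendsto_const])
    show "eventually (\<lambda>t. 1 = complex_of_nat (coef (m t) v) / of_nat t ^ w v) sequentially"
      using eventually_gt_at_top[of "0::nat"] by eventually_elim (simp add: m)
  qed
  have l2: "(\<lambda>t. complex_of_nat (coef (?m' t) v) / of_nat t ^ w v) \<longlonglongrightarrow> 1" for v
  proof (cases "v = j")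
    case True
    have "(\<lambda>t. complex_of_nat (coef (m t) v) / of_nat t ^ w v - 1 / of_nat t ^ w v) \<longlonglongrightarrow> 1 - 0"
      by (intro tendsto_diff l1 tendsto_divide_0[OF tendsto_const atinf])
    moreover have "eventually (\<lambda>t. complex_of_nat (coef (m t) v) / of_nat t ^ w v - 1 / of_nat t ^ w v =
      complex_of_nat (coef (?m' t) v) / of_nat t ^ w v) sequentially"
      using eventually_gt_at_top[of "0::nat"]
      by eventually_elim (simp add: m True lookup_minus of_nat_diff diff_divide_distrib Suc_leI)
    ultimately show ?thesis using Lim_transform_eventually by force
  next
    case False
    then show ?thesis using l1[of v] by (simp add: lookup_minus lookup_single when_def)
  qed
  have c1: "coef a k1 \<noteq> 0" using k1(1) by (simp add: in_keys_iff K_def)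
  have P1: "(\<lambda>t. ?P (m t) / of_nat t ^ wdeg w (snd k1)) \<longlonglongrightarrow> coef a k1"
    by (rule top_factor_tendsto) (use w l1 k1(1) k1_max in \<open>auto simp: K_def\<close>)
  have P2: "(\<lambda>t. ?P (?m' t) / of_nat t ^ wdeg w (snd k1)) \<longlonglongrightarrow> coef a k1"
    by (rule top_factor_tendsto) (use w l2 k1(1) k1_max in \<open>auto simp: K_def\<close>)
  have "(\<lambda>t. (?P (m t) / of_nat t ^ wdeg w (snd k1)) / (?P (?m' t) / of_nat t ^ wdeg w (snd k1)))
      \<longlonglongrightarrow> coef a k1 / coef a k1"
    by (intro tendsto_divide P1 P2 c1)
  then have "(\<lambda>t. Re ((?P (m t) / of_nat t ^ wdeg w (snd k1)) / (?P (?m' t) / of_nat t ^ wdeg w (snd k1))))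
      \<longlonglongrightarrow> Re 1"
    using c1 by (intro tendsto_Re) simp
  then have ev1: "eventually (\<lambda>t. Re ((?P (m t) / of_nat t ^ wdeg w (snd k1)) /
      (?P (?m' t) / of_nat t ^ wdeg w (snd k1))) > 0) sequentially"
    by (rule order_tendstoD) simp
  have ev2: "eventually (\<lambda>t. ?P (m t) / of_nat t ^ wdeg w (snd k1) \<noteq> 0) sequentially"
    by (rule tendsto_imp_eventually_ne[OF P1 c1])
  have ev3: "eventually (\<lambda>t. ?P (?m' t) / of_nat t ^ wdeg w (snd k1) \<noteq> 0) sequentially"
    by (rule tendsto_imp_eventually_ne[OF P2 c1])
  have ev4: "eventually (\<lambda>t. \<forall>v\<in>UNIV. t > coef m0 v) sequentially"
    by (subst eventually_ball_finite_distrib) (auto intro: eventually_gt_at_top)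
  from ev1 ev2 ev3 ev4 eventually_gt_at_top[of 0]
  have "eventually (\<lambda>t. t > 0 \<and> (\<forall>v. t > coef m0 v) \<and> ?P (m t) \<noteq> 0 \<and> ?P (?m' t) \<noteq> 0 \<and>
      Re (?P (m t) / ?P (?m' t)) > 0) sequentially"
    by eventually_elim auto
  then obtain t where t: "t > 0" "\<And>v. t > coef m0 v" "?P (m t) \<noteq> 0" "?P (?m' t) \<noteq> 0"
      "Re (?P (m t) / ?P (?m' t)) > 0"
    using eventually_happens'[OF trivial_limit_sequentially] by blast
  show ?thesis
  proof (intro exI[of _ "m t"] conjI allI impI)
    show "coef (m t) v > coef m0 v" for v
    proof -
      have "t ^ 1 \<le> t ^ w v" using t(1) w by (intro power_increasing) auto
      then show ?thesis using t(2)[of v] by (simp add: m)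
    qed
    show "?P (m t) \<noteq> 0" by fact
    assume real: "real_coeffs a"
    have R: "?P m \<in> \<real>" for m
      unfolding top_factor_def using real
      by (intro sum_in_Reals Reals_mult real_ffact) (auto simp: real_coeffs_def)
    have "?P (m t) / ?P (?m' t) \<in> \<real>" by (intro Reals_divide R)
    then have "?P (m t) = of_real (Re (?P (m t) / ?P (?m' t))) * ?P (?m' t)"
      using t(4) by (simp add: of_real_Re)
    with t(5) show "\<exists>r>0. ?P (m t) = of_real r * ?P (?m' t)" by blast
  qed
qed

subsection \<open>Affine substitutions\<close>

lemma finite_exponent_box: "finite {k :: 'v::finite \<Rightarrow>\<^sub>0 nat. \<forall>v. coef k v \<le> n v}"
proof (rule finite_imageD)
  have "coef ` {k. \<forall>v. coef k v \<le> n v} \<subseteq> (\<Pi>\<^sub>E v\<in>UNIV. {..n v})" by auto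
  then show "finite (coef ` {k. \<forall>v. coef k v \<le> n v})"
    by (rule finite_subset) (auto intro: finite_PiE)
  show "inj_on coef {k. \<forall>v. coef k v \<le> n v}" by (rule inj_onI) (simp add: poly_mapping_eqI)
qed

lemma sum_exponent_box:
  fixes F :: "'v::finite \<Rightarrow> nat \<Rightarrow> 'c::comm_semiring_1"
  shows "(\<Sum>k | \<forall>v. coef k v \<le> n v. \<Prod>v\<in>UNIV. F v (coef k v)) = (\<Prod>v\<in>UNIV. \<Sum>j\<le>n v. F v j)"
proof -
  have "(\<Prod>v\<in>UNIV. \<Sum>j\<le>n v. F v j) = (\<Sum>p\<in>(\<Pi>\<^sub>E v\<in>UNIV. {..n v}). \<Prod>v\<in>UNIV. F v (p v))"
    by (rule prod_sum_PiE) auto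
  also have "\<dots> = (\<Sum>k | \<forall>v. coef k v \<le> n v. \<Prod>v\<in>UNIV. F v (coef k v))"
    by (rule sum.reindex_bij_witness[of _ coef Abs_poly_mapping]) auto
  finally show ?thesis ..
qed

text \<open>This is the coefficient of x^k in the product of the powers (c_v x_v +
  y_v)^(m_v).\<close>

definition affine_term :: "('v::finite \<Rightarrow> complex) \<Rightarrow> ('v \<Rightarrow> complex) \<Rightarrow> ('v \<Rightarrow>\<^sub>0 nat) \<Rightarrow> ('v \<Rightarrow>\<^sub>0 nat) \<Rightarrow> complex"
  where "affine_term c y m k =
    (\<Prod>v\<in>UNIV. of_nat (coef m v choose coef k v) * c v ^ coef k v * y v ^ (coef m v - coef k v))"

text \<open>Given by explicit coefficients, because leading terms and imaginary parts of the
  substituted polynomial are read off from them.\<close>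

definition affine_subst :: "('v::finite \<Rightarrow> complex) \<Rightarrow> ('v \<Rightarrow> complex) \<Rightarrow> 'v cpoly \<Rightarrow> 'v cpoly"
  where "affine_subst c y f = Abs_poly_mapping (\<lambda>k. \<Sum>m\<in>supp f. coef f m * affine_term c y m k)"

lemma affine_term_nonzero:
  assumes "affine_term c y m k \<noteq> 0"
  shows "coef k v \<le> coef m v"
proof (rule ccontr)
  assume "\<not> coef k v \<le> coef m v"
  then have "of_nat (coef m v choose coef k v) * c v ^ coef k v * y v ^ (coef m v - coef k v) = 0"
    by (simp add: binomial_eq_0)
  then have "affine_term c y m k = 0" unfolding affine_term_def by (intro prod_zero) auto
  with assms show False by simp
qed

lemma affine_term_self: "affine_term c y m m = mpow c m"
  by (simp add: affine_term_def mpow_def)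

lemma coef_affine: "coef (affine_subst c y f) k = (\<Sum>m\<in>supp f. coef f m * affine_term c y m k)"
proof -
  have "{k. (\<Sum>m\<in>supp f. coef f m * affine_term c y m k) \<noteq> 0} \<subseteq>
      (\<Union>m\<in>supp f. {k. \<forall>v. coef k v \<le> coef m v})"
  proof
    fix k assume "k \<in> {k. (\<Sum>m\<in>supp f. coef f m * affine_term c y m k) \<noteq> 0}"
    then obtain m where "m \<in> supp f" "coef f m * affine_term c y m k \<noteq> 0"
      by (metis (mono_tags, lifting) mem_Collect_eq sum.neutral)
    then show "k \<in> (\<Union>m\<in>supp f. {k. \<forall>v. coef k v \<le> coef m v})"
      using affine_term_nonzero[of c y m k] by auto
  qed
  then have "finite {k. (\<Sum>m\<in>supp f. coef f m * affine_term c y m k) \<noteq> 0}"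
    by (rule finite_subset) (auto intro: finite_exponent_box)
  then show ?thesis by (simp add: affine_subst_def lookup_Abs_poly_mapping)
qed

lemma affine_coef_nonzero:
  assumes "coef (affine_subst c y f) k \<noteq> 0"
  shows "\<exists>m\<in>supp f. \<forall>v. coef k v \<le> coef m v"
proof -
  obtain m where "m \<in> supp f" "coef f m * affine_term c y m k \<noteq> 0"
    using assms unfolding coef_affine by (metis (mono_tags, lifting) sum.neutral)
  then show ?thesis using affine_term_nonzero[of c y m k] by (intro bexI[of _ m]) auto
qed

lemma peval_affine: "peval (affine_subst c y f) x = peval f (\<lambda>v. c v * x v + y v)"
proof -
  obtain L where L: "\<forall>m\<in>supp f. \<forall>v. coef m v \<le> L" using ex_coef_bound[of "supp f"] by auto
  define S where "S = {k :: 'a \<Rightarrow>\<^sub>0 nat. \<forall>v. coef k v \<le> L}"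
  have S: "finite S" unfolding S_def by (rule finite_exponent_box)
  have sub: "supp (affine_subst c y f) \<subseteq> S"
  proof
    fix k assume "k \<in> supp (affine_subst c y f)"
    then have "coef (affine_subst c y f) k \<noteq> 0" by (simp add: in_keys_iff)
    then obtain m where "m \<in> supp f" "\<forall>v. coef k v \<le> coef m v"
      using affine_coef_nonzero by blast
    with L show "k \<in> S" unfolding S_def using order_trans by blast
  qed
  have one: "(\<Sum>k\<in>S. affine_term c y m k * mpow x k) = mpow (\<lambda>v. c v * x v + y v) m"
    if "m \<in> supp f" for m
  proof -
    have "(\<Sum>k\<in>S. affine_term c y m k * mpow x k) =
      (\<Sum>k | \<forall>v. coef k v \<le> L. \<Prod>v\<in>UNIV. (\<lambda>j. of_nat (coef m v choose j) * c v ^ j *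
         y v ^ (coef m v - j) * x v ^ j) (coef k v))"
      by (simp add: S_def affine_term_def mpow_def prod.distrib)
    also have "\<dots> = (\<Prod>v\<in>UNIV. \<Sum>j\<le>L. of_nat (coef m v choose j) * c v ^ j *
         y v ^ (coef m v - j) * x v ^ j)"
      by (rule sum_exponent_box)
    also have "\<dots> = mpow (\<lambda>v. c v * x v + y v) m"
      unfolding mpow_def
    proof (intro prod.cong refl)
      fix v
      have "(\<Sum>j\<le>L. of_nat (coef m v choose j) * c v ^ j * y v ^ (coef m v - j) * x v ^ j) =
        (\<Sum>j\<le>coef m v. of_nat (coef m v choose j) * c v ^ j * y v ^ (coef m v - j) * x v ^ j)"
        by (rule sum.mono_neutral_right) (use L that in \<open>auto simp: binomial_eq_0\<close>)
      also have "\<dots> = (c v * x v + y v) ^ coef m v"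
        unfolding binomial_ring by (intro sum.cong refl) (simp add: power_mult_distrib)
      finally show "(\<Sum>j\<le>L. of_nat (coef m v choose j) * c v ^ j * y v ^ (coef m v - j) * x v ^ j) =
        (c v * x v + y v) ^ coef m v" .
    qed
    finally show ?thesis .
  qed
  have "peval (affine_subst c y f) x = (\<Sum>k\<in>S. \<Sum>m\<in>supp f. coef f m * (affine_term c y m k * mpow x k))"
    by (simp add: peval_superset[OF S sub] coef_affine sum_distrib_right mult.assoc)
  also have "\<dots> = (\<Sum>m\<in>supp f. coef f m * (\<Sum>k\<in>S. affine_term c y m k * mpow x k))"
    by (subst sum.swap) (simp add: sum_distrib_left)
  also have "\<dots> = peval f (\<lambda>v. c v * x v + y v)"
    by (simp add: one peval_mpow[of f])
  finally show ?thesis .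
qed

lemma wdeg_le_cases:
  assumes "\<And>v. w v \<ge> 1" "\<forall>v. coef k v \<le> coef m v" "k \<noteq> m"
  shows "wdeg w k < wdeg w m"
proof -
  obtain u where "coef k u \<noteq> coef m u" using assms(3) by (auto simp: poly_mapping_eq_iff fun_eq_iff)
  with assms(2) have "coef k u < coef m u" by (simp add: le_neq_implies_less)
  then show ?thesis unfolding wdeg_def using assms(1,2)
    by (intro sum_strict_mono_ex1) (auto intro!: bexI[of _ u] mult_strict_left_mono simp: Suc_le_eq)
qed

text \<open>Expanding a monomial only lowers exponents coordinatewise, and with positive weights
  this lowers the weighted degree unless nothing changes.\<close>

lemma lead_affine:
  assumes "lead w m f" "\<And>v. w v \<ge> 1"
  shows "lead w m (affine_subst c y f)"
  unfolding lead_def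
proof (intro ballI impI)
  fix k assume "k \<in> supp (affine_subst c y f)" "k \<noteq> m"
  then have "coef (affine_subst c y f) k \<noteq> 0" by (simp add: in_keys_iff)
  then obtain m' where m': "m' \<in> supp f" "\<forall>v. coef k v \<le> coef m' v"
    using affine_coef_nonzero by blast
  show "wdeg w k < wdeg w m"
  proof (cases "m' = m")
    case True
    then show ?thesis using wdeg_le_cases[of w k m] assms(2) m' \<open>k \<noteq> m\<close> by auto
  next
    case False
    then have "wdeg w m' < wdeg w m" using assms(1) m' by (auto simp: lead_def)
    moreover have "wdeg w k \<le> wdeg w m'" using wdeg_le_cases[of w k m'] assms(2) m' by (cases "k = m'") auto
    ultimately show ?thesis by simp
  qed
qed

lemma sum_eq_single:
  assumes "finite S" "\<And>x. x \<in> S \<Longrightarrow> x \<noteq> a \<Longrightarrow> g x = 0" "a \<notin> S \<Longrightarrow> g a = 0"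
  shows "sum g S = g a"
proof (cases "a \<in> S")
  case True
  have "sum g S = g a + sum g (S - {a})" by (rule sum.remove) (use assms True in auto)
  also have "sum g (S - {a}) = 0" by (rule sum.neutral) (use assms in auto)
  finally show ?thesis by simp
next
  case False
  then show ?thesis using assms by (metis sum.neutral)
qed

text \<open>No lower monomial of f can produce x^m after expansion. The result does not involve y,
  which keeps the operator from annihilating any member of the family at once.\<close>

lemma coef_affine_lead:
  assumes "lead w m f" "\<And>v. w v \<ge> 1"
  shows "coef (affine_subst c y f) m = coef f m * mpow c m"
proof -
  have "coef (affine_subst c y f) m = coef f m * affine_term c y m m"
    unfolding coef_affine
  proof (rule sum_eq_single)
    fix m' assume m': "m' \<in> supp f" "m' \<noteq> m"
    then have "wdeg w m' < wdeg w m" using assms(1) by (auto simp: lead_def)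
    then have "\<not> (\<forall>v. coef m v \<le> coef m' v)" using wdeg_le_cases[of w m m'] assms(2) m'(2) by auto
    then show "coef f m' * affine_term c y m' m = 0" using affine_term_nonzero[of c y m' m] by auto
  qed (auto simp: in_keys_iff)
  then show ?thesis by (simp add: affine_term_self)
qed

subsection \<open>Real and imaginary parts\<close>

definition im_part :: "'v cpoly \<Rightarrow> 'v cpoly"
  where "im_part f = Poly_Mapping.map (\<lambda>c. of_real (Im c)) f"

definition re_part :: "'v cpoly \<Rightarrow> 'v cpoly"
  where "re_part f = Poly_Mapping.map (\<lambda>c. of_real (Re c)) f"

lemma coef_im_part [simp]: "coef (im_part f) m = of_real (Im (coef f m))"
  by (simp add: im_part_def map.rep_eq when_def)

lemma coef_re_part [simp]: "coef (re_part f) m = of_real (Re (coef f m))"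
  by (simp add: re_part_def map.rep_eq when_def)

lemma lead_re_part: "lead w m f \<Longrightarrow> lead w m (re_part f)"
  by (auto simp: lead_def in_keys_iff)

lemma peval_re_im: "peval f x = peval (re_part f) x + \<i> * peval (im_part f) x"
proof -
  have "f = re_part f + pconst \<i> * im_part f"
    by (rule poly_mapping_eqI) (simp add: lookup_add coef_pconst_mult complex_eq_iff)
  then have "peval f x = peval (re_part f + pconst \<i> * im_part f) x" by simp
  then show ?thesis by (simp add: peval_add peval_mult)
qed

lemma coef_affine_cnj:
  assumes "real_coeffs f" "\<And>v. c v \<in> \<real>"
  shows "coef (affine_subst c (\<lambda>v. cnj (y v)) f) k = cnj (coef (affine_subst c y f) k)"
proof -
  have "cnj (coef f m) = coef f m" for m using assms(1) by (auto simp: real_coeffs_def Reals_cnj_iff)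
  moreover have "cnj (c v) = c v" for v using assms(2) by (auto simp: Reals_cnj_iff)
  ultimately show ?thesis by (simp add: coef_affine affine_term_def)
qed

text \<open>For real f and c, conjugating the shift conjugates all coefficients. The two signs of
  \<i> thus correspond to shifts by y and by its conjugate, to be compared by
  Hermite--Biehler.\<close>

lemma peval_re_im_diff:
  assumes "real_coeffs f" "\<And>v. c v \<in> \<real>"
  shows "peval (affine_subst c (\<lambda>v. cnj (y v)) f) x =
    peval (re_part (affine_subst c y f)) x - \<i> * peval (im_part (affine_subst c y f)) x"
proof -
  have "affine_subst c (\<lambda>v. cnj (y v)) f = re_part (affine_subst c y f) - pconst \<i> * im_part (affine_subst c y f)"
    by (rule poly_mapping_eqI)
       (simp add: lookup_minus coef_pconst_mult complex_eq_iff coef_affine_cnj[OF assms])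
  then have "affine_subst c (\<lambda>v. cnj (y v)) f = re_part (affine_subst c y f) + pconst (-\<i>) * im_part (affine_subst c y f)"
    by (intro poly_mapping_eqI) (simp add: lookup_add lookup_minus coef_pconst_mult)
  then show ?thesis by (simp add: peval_add peval_mult)
qed

text \<open>The only monomial below the leading one that can reach weighted degree
  \<open>wdeg w m - 1\<close> with an imaginary coefficient comes from lowering the exponent of the
  variable \<open>j\<close> of weight one.\<close>

lemma
  fixes f :: "'v::finite cpoly" and c :: "'v \<Rightarrow> complex"
  assumes f: "lead w m f" "real_coeffs f" and c: "\<And>v. c v \<in> \<real>"
    and w: "w j = 1" "\<And>v. v \<noteq> j \<Longrightarrow> w v \<ge> 2" and j: "coef m j \<ge> 1"
  defines "m1 \<equiv> m - Poly_Mapping.single j 1"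
  shows lead_im_part_affine: "lead w m1 (im_part (affine_subst c y f))"
    and coef_im_part_affine: "coef (im_part (affine_subst c y f)) m1 =
      coef f m * of_nat (coef m j) * mpow c m1 * of_real (Im (y j))"
proof -
  have w1: "w v \<ge> 1" for v using w(1) w(2)[of v] by (cases "v = j") simp_all
  have m: "m = m1 + Poly_Mapping.single j 1"
    using j by (intro poly_mapping_eqI) (auto simp: m1_def lookup_add lookup_minus lookup_single when_def)
  have wm: "wdeg w m = Suc (wdeg w m1)"
    by (subst m) (simp add: wdeg_add wdeg_single w)
  have real: "coef f m' \<in> \<real>" for m' using f(2) by (simp add: real_coeffs_def)
  have self: "affine_term c y k k \<in> \<real>" for k
    unfolding affine_term_self mpow_def by (intro prod_in_Reals Reals_power c)
  \<comment> \<open>A monomial m' other than m has weighted degree at most that of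
    \<open>m1\<close>, so it reaches such a k only as k = m', where its contribution is
    real.\<close>
  have Im_coef: "Im (coef (affine_subst c y f) k) = Im (coef f m * affine_term c y m k)"
    if k: "wdeg w m1 \<le> wdeg w k" for k
  proof -
    have "Im (coef (affine_subst c y f) k) = (\<Sum>m'\<in>supp f. Im (coef f m' * affine_term c y m' k))"
      by (simp add: coef_affine)
    also have "\<dots> = Im (coef f m * affine_term c y m k)"
    proof (rule sum_eq_single)
      fix m' assume m': "m' \<in> supp f" "m' \<noteq> m"
      then have lt: "wdeg w m' < wdeg w m" using f by (auto simp: lead_def)
      show "Im (coef f m' * affine_term c y m' k) = 0"
      proof (cases "affine_term c y m' k = 0")
        case False
        then have "\<forall>v. coef k v \<le> coef m' v" using affine_term_nonzero by blast
        moreover have "\<not> wdeg w k < wdeg w m'" using lt k wm by simp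
        ultimately have "k = m'" using wdeg_le_cases[of w k m'] w1 by blast
        then have "coef f m' * affine_term c y m' k \<in> \<real>" using self real by (intro Reals_mult) auto
        then show ?thesis by (simp add: complex_is_Real_iff)
      qed simp
    qed (auto simp: in_keys_iff)
    finally show ?thesis .
  qed
  show "lead w m1 (im_part (affine_subst c y f))"
    unfolding lead_def
  proof (intro ballI impI, rule ccontr)
    fix k assume k: "k \<in> supp (im_part (affine_subst c y f))" "k \<noteq> m1" "\<not> wdeg w k < wdeg w m1"
    from k(1) have "Im (coef (affine_subst c y f) k) \<noteq> 0" by (simp add: in_keys_iff)
    then have "Im (coef f m * affine_term c y m k) \<noteq> 0"
      using Im_coef[of k] k(3) by (metis not_less)
    then have nz: "affine_term c y m k \<noteq> 0" and "k \<noteq> m"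
      using self[of m] real[of m] by (auto simp: complex_is_Real_iff)
    have le: "coef k v \<le> coef m v" for v using nz by (rule affine_term_nonzero)
    define d where "d = m - k"
    have md: "m = k + d"
      using le by (intro poly_mapping_eqI) (simp add: d_def lookup_add lookup_minus)
    \<comment> \<open>Total weight at most 1 leaves d = 0 or the unit vector at j, all other
      variables having weight at least 2.\<close>
    have wd: "wdeg w d \<le> 1" using k(3) wm by (subst (asm) md) (simp add: wdeg_add)
    have term_le: "w v * coef d v \<le> 1" for v
      using wd member_le_sum[of v UNIV "\<lambda>v. w v * coef d v"] by (simp add: wdeg_def)
    have dv: "coef d v = 0" if "v \<noteq> j" for v
    proof (rule ccontr)
      assume "coef d v \<noteq> 0"
      with w(2)[OF that] have "2 * 1 \<le> w v * coef d v" by (intro mult_le_mono) auto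
      with term_le[of v] show False by simp
    qed
    have "coef d j \<noteq> 0"
    proof
      assume "coef d j = 0"
      with dv have "d = 0" by (intro poly_mapping_eqI) (metis lookup_zero)
      with md \<open>k \<noteq> m\<close> show False by simp
    qed
    with term_le[of j] w(1) have "coef d j = 1" by simp
    with dv have "d = Poly_Mapping.single j 1"
      by (intro poly_mapping_eqI) (auto simp: lookup_single when_def)
    with md m k(2) show False by simp
  qed
  have "affine_term c y m m1 = (\<Prod>v\<in>UNIV. c v ^ coef m1 v * (if v = j then of_nat (coef m j) * y j else 1))"
    unfolding affine_term_def
  proof (intro prod.cong refl)
    fix v
    show "of_nat (coef m v choose coef m1 v) * c v ^ coef m1 v * y v ^ (coef m v - coef m1 v) =
      c v ^ coef m1 v * (if v = j then of_nat (coef m j) * y j else 1)"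
    proof (cases "v = j")
      case True
      obtain n where n: "coef m j = Suc n" using j by (cases "coef m j") auto
      have "coef m1 j = n" by (simp add: m1_def lookup_minus n)
      moreover have "Suc n choose n = Suc n" using binomial_symmetric[of n "Suc n"] by simp
      ultimately show ?thesis using True n by simp
    next
      case False
      then have "coef m1 v = coef m v" by (simp add: m1_def lookup_minus lookup_single)
      with False show ?thesis by simp
    qed
  qed
  also have "\<dots> = mpow c m1 * (of_nat (coef m j) * y j)"
    by (simp add: prod.distrib mpow_def)
  finally have at: "affine_term c y m m1 = mpow c m1 * (of_nat (coef m j) * y j)" .
  obtain r where r: "coef f m = of_real r" using real[of m] by (auto elim: Reals_cases)
  have "mpow c m1 \<in> \<real>" unfolding mpow_def by (intro prod_in_Reals Reals_power c)
  then obtain s where s: "mpow c m1 = of_real s" by (auto elim: Reals_cases)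
  show "coef (im_part (affine_subst c y f)) m1 =
      coef f m * of_nat (coef m j) * mpow c m1 * of_real (Im (y j))"
    unfolding coef_im_part Im_coef[OF order_refl] at r s
    by (simp add: complex_eq_iff)
qed

subsection \<open>A Hermite--Biehler inequality\<close>

text \<open>All roots lie in the open lower half plane, hence closer to -i than to i. Splitting off
  one linear factor at a time multiplies these comparisons.\<close>

lemma norm_poly_conj_le:
  fixes p :: "complex poly"
  assumes "\<And>t. Im t \<ge> 0 \<Longrightarrow> poly p t \<noteq> 0"
  shows "norm (poly p (-\<i>)) \<le> norm (poly p \<i>)"
  using assms
proof (induction "degree p" arbitrary: p)
  case 0
  then obtain a where "p = [:a:]" by (metis degree_eq_zeroE)
  then show ?case by simp
next
  case (Suc n)
  have "\<nexists>a l. a \<noteq> 0 \<and> l = 0 \<and> p = pCons a l" using Suc.hyps(2) by auto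
  then obtain z where z: "poly p z = 0" using fundamental_theorem_of_algebra_alt by blast
  then have Imz: "Im z < 0" using Suc.prems[of z] by force
  from z obtain q where q: "p = [:-z, 1:] * q" by (auto simp: poly_eq_0_iff_dvd)
  have "p \<noteq> 0" using Suc.hyps(2) by auto
  with q have "q \<noteq> 0" by auto
  then have "n = degree q" using Suc.hyps(2) by (simp add: q degree_mult_eq del: mult_pCons_left)
  moreover have "poly q t \<noteq> 0" if "Im t \<ge> 0" for t
    using Suc.prems[OF that] by (simp add: q)
  ultimately have le: "norm (poly q (-\<i>)) \<le> norm (poly q \<i>)" by (rule Suc.hyps(1))
  have "norm (-\<i> - z) \<le> norm (\<i> - z)"
    using Imz by (simp add: cmod_def real_sqrt_le_iff) (simp add: power2_eq_square algebra_simps)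
  then have "norm (-\<i> - z) * norm (poly q (-\<i>)) \<le> norm (\<i> - z) * norm (poly q \<i>)"
    by (intro mult_mono le) auto
  then have "norm ((-\<i> - z) * poly q (-\<i>)) \<le> norm ((\<i> - z) * poly q \<i>)"
    by (simp only: norm_mult)
  then show ?case by (simp add: q algebra_simps)
qed

lemma ex_poly_on_line:
  "\<exists>p. \<forall>t. poly p t = peval f (\<lambda>v. a v + t * b v)"
proof
  show "\<forall>t. poly (\<Sum>m\<in>supp f. smult (coef f m) (\<Prod>v\<in>UNIV. [:a v, b v:] ^ coef m v)) t =
    peval f (\<lambda>v. a v + t * b v)"
    by (simp add: poly_sum poly_prod peval_mpow mpow_def)
qed

lemma stableD: "stable f \<Longrightarrow> (\<And>v. Im (z v) > 0) \<Longrightarrow> peval f z \<noteq> 0"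
  by (simp add: stable_def)

text \<open>On the line z + t b the polynomial has no zero for Im t \<ge> 0, so the univariate
  inequality applies at t = i and t = -i.\<close>

lemma stable_norm_conj_le:
  assumes "stable f" "\<And>v. Im (z v) > 0" "\<And>v. b v \<ge> 0"
  shows "norm (peval f (\<lambda>v. z v - \<i> * of_real (b v))) \<le> norm (peval f (\<lambda>v. z v + \<i> * of_real (b v)))"
proof -
  obtain p where p: "\<And>t. poly p t = peval f (\<lambda>v. z v + t * of_real (b v))"
    using ex_poly_on_line[of f z "\<lambda>v. of_real (b v)"] by blast
  have "norm (poly p (-\<i>)) \<le> norm (poly p \<i>)"
  proof (rule norm_poly_conj_le)
    fix t assume "Im t \<ge> 0"
    then have "Im (z v + t * of_real (b v)) > 0" for v
      using assms(2)[of v] assms(3)[of v] by (simp add: add_pos_nonneg)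
    then show "poly p t \<noteq> 0" unfolding p by (intro stableD[OF assms(1)])
  qed
  then show ?thesis by (simp add: p)
qed

subsection \<open>Linearity and rescaling of Weyl operators\<close>

lemma pderiv_multi_add: "pderiv_multi \<beta> (f + g) = pderiv_multi \<beta> f + pderiv_multi \<beta> g"
  by (rule poly_mapping_eqI) (simp add: lookup_pderiv_multi lookup_add distrib_left)

lemma pderiv_multi_pconst_mult: "pderiv_multi \<beta> (pconst c * f) = pconst c * pderiv_multi \<beta> f"
  by (rule poly_mapping_eqI) (simp add: lookup_pderiv_multi coef_pconst_mult mult.left_commute)

lemma weyl_op_add: "weyl_op a (f + g) = weyl_op a f + weyl_op a g"
  by (simp add: weyl_op_def pderiv_multi_add distrib_left sum.distrib case_prod_beta)

lemma weyl_op_pconst_mult: "weyl_op a (pconst c * f) = pconst c * weyl_op a f"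
  by (simp add: weyl_op_def pderiv_multi_pconst_mult sum_distrib_left case_prod_beta mult.left_commute)

lemma weyl_op_0: "weyl_op 0 f = 0"
  by (simp add: weyl_op_def)

lemma real_coeffs_pconst: "c \<in> \<real> \<Longrightarrow> real_coeffs (pconst c)"
  by (simp add: real_coeffs_def pconst_def lookup_single when_def)

lemma real_coeffs_pvar: "real_coeffs (pvar v)"
  by (simp add: real_coeffs_def pvar_def lookup_single when_def)

lemma real_coeffs_1: "real_coeffs (1 :: 'v cpoly)"
  using real_coeffs_pconst[of 1] by (simp add: pconst_def)

lemma real_coeffs_add: "real_coeffs f \<Longrightarrow> real_coeffs g \<Longrightarrow> real_coeffs (f + g)"
  by (simp add: real_coeffs_def lookup_add)

lemma real_coeffs_sum: "(\<And>i. i \<in> A \<Longrightarrow> real_coeffs (f i)) \<Longrightarrow> real_coeffs (sum f A)"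
  by (auto simp: real_coeffs_def lookup_sum)

lemma real_coeffs_mult: "real_coeffs f \<Longrightarrow> real_coeffs g \<Longrightarrow> real_coeffs (f * g :: 'v cpoly)"
  by (auto simp: real_coeffs_def coef_mult[OF finite_keys finite_keys order_refl order_refl]
      intro!: sum_in_Reals)

lemma real_coeffs_power: "real_coeffs f \<Longrightarrow> real_coeffs (f ^ n :: 'v cpoly)"
  by (induction n) (auto intro: real_coeffs_1 real_coeffs_mult)

lemma real_coeffs_prod:
  "(\<And>i. i \<in> A \<Longrightarrow> real_coeffs (f i)) \<Longrightarrow> real_coeffs (prod f A :: 'v cpoly)"
  by (induction A rule: infinite_finite_induct) (auto intro: real_coeffs_1 real_coeffs_mult)

lemma real_coeffs_pderiv_multi: "real_coeffs f \<Longrightarrow> real_coeffs (pderiv_multi \<beta> f)"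
  unfolding real_coeffs_def lookup_pderiv_multi
  by (intro allI Reals_mult prod_in_Reals) (auto simp: pochhammer_prod simp del: of_nat_Suc intro!: prod_in_Reals)

lemma real_coeffs_weyl_op: "real_coeffs a \<Longrightarrow> real_coeffs f \<Longrightarrow> real_coeffs (weyl_op a f)"
  unfolding weyl_op_def case_prod_beta pmonom_def
  by (intro real_coeffs_sum real_coeffs_mult real_coeffs_pconst real_coeffs_pderiv_multi)
     (auto simp: real_coeffs_def lookup_single when_def)

definition wscale :: "('v::finite \<Rightarrow> real) \<Rightarrow> ('v \<Rightarrow> real) \<Rightarrow> 'v weyl_coeffs \<Rightarrow> 'v weyl_coeffs"
  where "wscale \<mu> lam a =
    Poly_Mapping.mapp (\<lambda>k c. of_real (mpow \<mu> (fst k)) * of_real (mpow lam (snd k)) * c) a"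

lemma coef_wscale:
  "coef (wscale \<mu> lam a) k = of_real (mpow \<mu> (fst k)) * of_real (mpow lam (snd k)) * coef a k"
  by (auto simp: wscale_def lookup_mapp when_def in_keys_iff)

lemma supp_wscale: "supp (wscale \<mu> lam a) \<subseteq> supp a"
  unfolding wscale_def by (rule keys_mapp_subset)

lemma real_coeffs_wscale: "real_coeffs a \<Longrightarrow> real_coeffs (wscale \<mu> lam a)"
  by (simp add: real_coeffs_def coef_wscale)

lemma of_real_mpow: "of_real (mpow \<mu> m) = mpow (\<lambda>v. of_real (\<mu> v)) m"
  by (simp add: mpow_def)

lemma weyl_op_wscale:
  "weyl_op (wscale \<mu> lam a) f = (\<Sum>k\<in>supp a.
     pconst (of_real (mpow \<mu> (fst k)) * of_real (mpow lam (snd k)) * coef a k) * pmonom (fst k) *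
     pderiv_multi (snd k) f)"
  by (subst weyl_op_superset[OF finite_keys supp_wscale]) (simp add: coef_wscale)

text \<open>At x = \<mu> y the affine argument is lam \<mu> y + (1 - lam \<mu>) y = y. The chain
  rule supplies lam^\<beta>, and evaluating z^\<alpha> at \<mu> y supplies \<mu>^\<alpha>.\<close>

lemma peval_weyl_op_wscale:
  "peval (weyl_op (wscale \<mu> lam a) f) y =
   peval (weyl_op a (affine_subst (\<lambda>v. of_real (lam v)) (\<lambda>v. of_real (1 - lam v * \<mu> v) * y v) f))
     (\<lambda>v. of_real (\<mu> v) * y v)"
proof -
  let ?c = "\<lambda>v. complex_of_real (lam v)" and ?b = "\<lambda>v. of_real (1 - lam v * \<mu> v) * y v"
  have "peval (pderiv_multi \<beta> (affine_subst ?c ?b f)) (\<lambda>v. of_real (\<mu> v) * y v) =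
      mpow ?c \<beta> * peval (pderiv_multi \<beta> f) y" for \<beta>
  proof -
    have "(\<lambda>v. ?c v * (of_real (\<mu> v) * y v) + ?b v) = y"
      by (rule ext) (simp add: algebra_simps)
    then show ?thesis
      using peval_pderiv_multi_affine[of "affine_subst ?c ?b f" f ?c ?b \<beta> "\<lambda>v. of_real (\<mu> v) * y v",
        OF peval_affine] by simp
  qed
  then show ?thesis
    by (simp add: weyl_op_wscale peval_sum peval_mult peval_weyl_op mpow_mult of_real_mpow mult_ac)
qed

subsection \<open>Operators applied to polynomials with a good leading term\<close>

lemma weyl_op_nonzero_of_lead:
  assumes "dominant w a k0" "lead w m f" "coef f m \<noteq> 0"
    "top_factor a k0 (\<lambda>v. of_nat (coef m v)) \<noteq> 0"
  shows "weyl_op a f \<noteq> 0"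
proof
  assume "weyl_op a f = 0"
  with weyl_lead_tendsto[OF assms(1,2)]
  have "((\<lambda>\<rho>::real. 0) \<longlongrightarrow> coef f m * top_factor a k0 (\<lambda>v. of_nat (coef m v))) at_top"
    by simp
  then have "coef f m * top_factor a k0 (\<lambda>v. of_nat (coef m v)) = 0"
    using tendsto_unique[OF trivial_limit_at_top_linorder _ tendsto_const] by blast
  with assms show False by simp
qed

lemma stable_affine_subst:
  assumes "stable f" "\<And>v. lam v > 0" "\<And>v. Im (y v) > 0"
  shows "stable (affine_subst (\<lambda>v. of_real (lam v)) y f)"
  unfolding stable_def peval_affine
  using assms by (auto intro!: stableD[OF assms(1)] add_pos_pos)

text \<open>The point y is fixed before the auxiliary polynomial is formed. Its leading coefficient
  is nonzero for every y, so the preserver returns a stable polynomial, evaluated at \<mu> y in the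
  upper half space.\<close>

lemma stable_wscale:
  assumes pres: "\<And>h. stable h \<Longrightarrow> stable (weyl_op a h) \<or> weyl_op a h = 0"
    and w: "\<And>v. w v \<ge> 1" and k0: "dominant w a k0"
    and g: "stable g" "lead w m g" "coef g m \<noteq> 0"
    and m: "top_factor a k0 (\<lambda>v. of_nat (coef m v)) \<noteq> 0"
    and sc: "\<And>v. 0 < \<mu> v" "\<And>v. 0 < lam v" "\<And>v. lam v * \<mu> v < 1"
  shows "stable (weyl_op (wscale \<mu> lam a) g)"
  unfolding stable_def
proof (intro allI impI)
  fix y :: "'a \<Rightarrow> complex" assume y: "\<forall>v. Im (y v) > 0"
  let ?h = "affine_subst (\<lambda>v. of_real (lam v)) (\<lambda>v. of_real (1 - lam v * \<mu> v) * y v) g"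
  have "stable ?h" using sc y by (intro stable_affine_subst g) auto
  moreover have "weyl_op a ?h \<noteq> 0"
    using lead_affine[OF g(2) w] coef_affine_lead[OF g(2) w] g(3) sc(2)
    by (intro weyl_op_nonzero_of_lead[OF k0 _ _ m]) (auto intro!: mpow_nonzero simp: less_imp_neq[symmetric])
  ultimately have "stable (weyl_op a ?h)" using pres by blast
  then show "peval (weyl_op (wscale \<mu> lam a) g) y \<noteq> 0"
    unfolding peval_weyl_op_wscale by (rule stableD) (use sc y in auto)
qed

text \<open>The sign of the imaginary part of \<open>T A / T B\<close> is constant because the upper half space is
  connected; it is computed on the curve \<open>x\<^sub>v = \<i> \<rho>\<^bsup>w v\<^esup>\<close> for large \<open>\<rho>\<close>.\<close>

lemma real_stable_wscale:
  fixes a :: "'v::finite weyl_coeffs" and w :: "'v \<Rightarrow> nat"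
  assumes pres: "\<And>h. real_stable h \<Longrightarrow> real_stable (weyl_op a h) \<or> weyl_op a h = 0"
    and w: "w j = 1" "\<And>v. v \<noteq> j \<Longrightarrow> w v \<ge> 2" and k0: "dominant w a k0"
    and g: "real_stable g" "lead w m g" "coef g m \<noteq> 0" and mj: "coef m j \<ge> 1"
    and strict: "\<And>z b. (\<And>v. Im (z v) > 0) \<Longrightarrow> (\<And>v. b v > 0) \<Longrightarrow>
      norm (peval g (\<lambda>v. z v - \<i> * of_real (b v))) < norm (peval g (\<lambda>v. z v + \<i> * of_real (b v)))"
    and m: "top_factor a k0 (\<lambda>v. of_nat (coef m v)) \<noteq> 0"
    and r: "r > 0" "top_factor a k0 (\<lambda>v. of_nat (coef m v)) =
      of_real r * top_factor a k0 (\<lambda>v. of_nat (coef (m - Poly_Mapping.single j 1) v))"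
    and sc: "\<And>v. 0 < \<mu> v" "\<And>v. 0 < lam v" "\<And>v. lam v * \<mu> v < 1"
  shows "stable (weyl_op (wscale \<mu> lam a) g)"
  unfolding stable_def
proof (intro allI impI)
  fix y :: "'v \<Rightarrow> complex" assume y: "\<forall>v. Im (y v) > 0"
  have w1: "w v \<ge> 1" for v using w(1) w(2)[of v] by (cases "v = j") simp_all
  have gr: "real_coeffs g" using g(1) by (simp add: real_stable_def)
  define c where "c v = complex_of_real (lam v)" for v
  define u where "u v = of_real (1 - lam v * \<mu> v) * y v" for v
  define m1 where "m1 = m - Poly_Mapping.single j 1"
  have cR: "c v \<in> \<real>" for v by (simp add: c_def)
  have Imu: "Im (u v) > 0" for v using sc(3)[of v] y by (simp add: u_def)
  define h where "h = affine_subst c u g"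
  define A where "A = re_part h"
  define B where "B = im_part h"
  define comb where "comb \<alpha> \<beta> = pconst (of_real \<alpha>) * A + pconst (of_real \<beta>) * B" for \<alpha> \<beta> :: real
  let ?P = "\<lambda>m. top_factor a k0 (\<lambda>v. of_nat (coef m v))"
  have Pm1: "?P m1 \<noteq> 0" using m r(2) by (auto simp: m1_def)
  have leadh: "lead w m h" unfolding h_def by (rule lead_affine[OF g(2) w1])
  have mpc: "mpow c k = of_real (mpow lam k)" for k by (simp add: c_def[abs_def] of_real_mpow)
  have lampos: "mpow lam k > 0" for k by (simp add: mpow_def sc prod_pos)
  obtain q where q: "coef g m = of_real q"
    using gr by (auto simp: real_coeffs_def elim: Reals_cases)
  have q0: "q \<noteq> 0" using g(3) q by auto
  have coefh: "coef h m = of_real (q * mpow lam m)"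
    unfolding h_def coef_affine_lead[OF g(2) w1] by (simp add: q mpc)
  have coefA: "coef A m = of_real (q * mpow lam m)" by (simp add: A_def coefh)
  have leadB: "lead w m1 B" unfolding B_def h_def m1_def
    using g(2) gr cR w mj by (rule lead_im_part_affine)
  have coefB: "coef B m1 = of_real (q * real (coef m j) * mpow lam m1 * Im (u j))"
    unfolding B_def h_def m1_def
    by (subst coef_im_part_affine[OF g(2) gr cR w mj]) (simp_all add: q mpc)
  have coefB0: "coef B m1 \<noteq> 0"
    using q0 mj lampos[of m1] Imu[of j] unfolding coefB by (simp add: less_imp_neq[symmetric])
  have combR: "real_coeffs (comb \<alpha> \<beta>)" for \<alpha> \<beta>
    by (auto simp: real_coeffs_def comb_def lookup_add coef_pconst_mult A_def B_def)
  \<comment> \<open>With z = lam x + Re u and b = Im u, the values of g at z + ib and z - ib are A +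
    iB and A - iB at x. A vanishing nontrivial real combination would give them equal modulus,
    contrary to \<open>strict\<close>.\<close>
  have comb_stable: "stable (comb \<alpha> \<beta>)" if "\<alpha> \<noteq> 0 \<or> \<beta> \<noteq> 0" for \<alpha> \<beta>
    unfolding stable_def
  proof (intro allI impI notI)
    fix x :: "'v \<Rightarrow> complex" assume x: "\<forall>v. Im (x v) > 0" and 0: "peval (comb \<alpha> \<beta>) x = 0"
    define a1 where "a1 = peval A x"
    define b1 where "b1 = peval B x"
    let ?z = "\<lambda>v. c v * x v + of_real (Re (u v))"
    have Imz: "Im (?z v) > 0" for v using x sc(2)[of v] by (simp add: c_def)
    have "(\<lambda>v. ?z v + \<i> * of_real (Im (u v))) = (\<lambda>v. c v * x v + u v)"
      by (rule ext) (simp add: complex_eq_iff)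
    then have H: "peval g (\<lambda>v. ?z v + \<i> * of_real (Im (u v))) = a1 + \<i> * b1"
      by (simp add: a1_def b1_def A_def B_def flip: peval_affine h_def peval_re_im)
    have "(\<lambda>v. ?z v - \<i> * of_real (Im (u v))) = (\<lambda>v. c v * x v + cnj (u v))"
      by (rule ext) (simp add: complex_eq_iff)
    then have Hc: "peval g (\<lambda>v. ?z v - \<i> * of_real (Im (u v))) = a1 - \<i> * b1"
      using peval_affine[of c "\<lambda>v. cnj (u v)" g x]
      by (simp add: a1_def b1_def A_def B_def h_def peval_re_im_diff[OF gr cR])
    have lt: "norm (a1 - \<i> * b1) < norm (a1 + \<i> * b1)"
      unfolding H[symmetric] Hc[symmetric] by (rule strict[OF Imz Imu])
    have "of_real \<alpha> * a1 + of_real \<beta> * b1 = 0"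
      using 0 by (simp add: comb_def peval_add peval_mult a1_def b1_def)
    moreover have "(of_real \<alpha> - \<i> * of_real \<beta>) * (a1 + \<i> * b1) + (of_real \<alpha> + \<i> * of_real \<beta>) * (a1 - \<i> * b1) =
        2 * (of_real \<alpha> * a1 + of_real \<beta> * b1)"
      by (simp add: algebra_simps)
    ultimately have "(of_real \<alpha> - \<i> * of_real \<beta>) * (a1 + \<i> * b1) =
        - ((of_real \<alpha> + \<i> * of_real \<beta>) * (a1 - \<i> * b1))"
      by (simp add: eq_neg_iff_add_eq_0)
    then have "norm (of_real \<alpha> - \<i> * of_real \<beta>) * norm (a1 + \<i> * b1) =
        norm (of_real \<alpha> + \<i> * of_real \<beta>) * norm (a1 - \<i> * b1)"
      by (metis norm_minus_cancel norm_mult)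
    moreover have "norm (of_real \<alpha> - \<i> * of_real \<beta>) = norm (of_real \<alpha> + \<i> * of_real \<beta>)"
      by (simp add: cmod_def)
    moreover have "norm (of_real \<alpha> + \<i> * of_real \<beta>) \<noteq> 0"
      using that by (auto simp: complex_eq_iff)
    ultimately have "norm (a1 + \<i> * b1) = norm (a1 - \<i> * b1)" by simp
    with lt show False by simp
  qed
  \<comment> \<open>The leading exponent is m when \<alpha> \<noteq> 0, since B has no term at m,
    and \<open>m1\<close> otherwise. The top factor is nonzero at both.\<close>
  have comb_nz: "weyl_op a (comb \<alpha> \<beta>) \<noteq> 0" if "\<alpha> \<noteq> 0 \<or> \<beta> \<noteq> 0" for \<alpha> \<beta>
  proof (cases "\<alpha> = 0")
    case True
    have "lead w m1 (comb \<alpha> \<beta>)" using leadB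
      by (auto simp: True lead_def comb_def in_keys_iff lookup_add coef_pconst_mult)
    moreover have "coef (comb \<alpha> \<beta>) m1 \<noteq> 0" using coefB0 that True
      by (simp add: comb_def lookup_add coef_pconst_mult)
    ultimately show ?thesis using Pm1 by (intro weyl_op_nonzero_of_lead[OF k0])
  next
    case False
    have "lead w m (comb \<alpha> \<beta>)" using leadh
      by (auto simp: lead_def comb_def in_keys_iff lookup_add coef_pconst_mult A_def B_def)
    moreover have "coef (comb \<alpha> \<beta>) m \<noteq> 0" using False q0 lampos[of m]
      by (simp add: comb_def lookup_add coef_pconst_mult coefA B_def coefh less_imp_neq[symmetric])
    ultimately show ?thesis using m by (intro weyl_op_nonzero_of_lead[OF k0])
  qed
  define TA where "TA = peval (weyl_op a A)"
  define TB where "TB = peval (weyl_op a B)"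
  have comb_ne: "of_real \<alpha> * TA x + of_real \<beta> * TB x \<noteq> 0"
    if "\<alpha> \<noteq> 0 \<or> \<beta> \<noteq> 0" "\<And>v. Im (x v) > 0" for \<alpha> \<beta> :: real and x
  proof -
    have "real_stable (comb \<alpha> \<beta>)" using comb_stable combR that(1) by (simp add: real_stable_def)
    then have "stable (weyl_op a (comb \<alpha> \<beta>))"
      using pres comb_nz[OF that(1)] by (auto simp: real_stable_def)
    then have "peval (weyl_op a (comb \<alpha> \<beta>)) x \<noteq> 0" by (rule stableD) (rule that(2))
    then show ?thesis
      by (simp add: comb_def weyl_op_add weyl_op_pconst_mult peval_add peval_mult TA_def TB_def)
  qed
  have TB0: "TB x \<noteq> 0" if "\<And>v. Im (x v) > 0" for x
    using comb_ne[of 0 1 x] that by simp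
  have Q: "Im (TA x / TB x) \<noteq> 0" if x: "\<And>v. Im (x v) > 0" for x
  proof
    assume "Im (TA x / TB x) = 0"
    then have "TA x / TB x = of_real (Re (TA x / TB x))" by (simp add: complex_eq_iff)
    then have "TA x = of_real (Re (TA x / TB x)) * TB x" using TB0[OF x] by (simp add: field_simps)
    then have "of_real 1 * TA x + of_real (- Re (TA x / TB x)) * TB x = 0" by simp
    with comb_ne[of 1 "- Re (TA x / TB x)" x] x show False by simp
  qed
  obtain x0 where x0: "\<And>v. Im (x0 v) > 0" "Im (TA x0 / TB x0) > 0"
  proof -
    let ?X = "\<lambda>\<rho>. mpow (ray w \<rho>) (fst k0) / mpow (ray w \<rho>) (snd k0)"
    have m_eq: "m = m1 + Poly_Mapping.single j 1"
      using mj by (intro poly_mapping_eqI) (auto simp: m1_def lookup_add lookup_minus lookup_single when_def)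
    have lim: "((\<lambda>\<rho>. (TA (ray w \<rho>) / ?X \<rho> / mpow (ray w \<rho>) m) /
        (TB (ray w \<rho>) / ?X \<rho> / mpow (ray w \<rho>) m1)) \<longlongrightarrow>
        (coef A m * ?P m) / (coef B m1 * ?P m1)) at_top"
      unfolding TA_def TB_def using coefB0 Pm1
      by (intro tendsto_divide weyl_lead_tendsto[OF k0] leadB) (auto simp: A_def intro: lead_re_part leadh)
    \<comment> \<open>The sign of \<open>q\<close> and the top factor cancel in the quotient. What
      remains is built from the positive numbers lam_j, r, m_j and Im u_j.\<close>
    have "mpow lam m = mpow lam m1 * lam j" by (subst m_eq) (simp add: mpow_add mpow_single)
    then have "(coef A m * ?P m) / (coef B m1 * ?P m1) = of_real (lam j * r / (real (coef m j) * Im (u j)))"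
      using q0 lampos[of m1] Pm1 unfolding coefA coefB r(2)[folded m1_def]
      by (simp add: less_imp_neq[symmetric])
    moreover have "lam j * r / (real (coef m j) * Im (u j)) > 0"
      using sc(2)[of j] r(1) mj Imu[of j] by simp
    ultimately have "Re ((coef A m * ?P m) / (coef B m1 * ?P m1)) > 0" by simp
    from order_tendstoD(1)[OF tendsto_Re[OF lim] this] eventually_gt_at_top[of "0::real"]
    have "eventually (\<lambda>\<rho>. \<rho> > 0 \<and> Im (TA (ray w \<rho>) / TB (ray w \<rho>)) > 0) at_top"
    proof eventually_elim
      case (elim \<rho>)
      have nz: "mpow (ray w \<rho>) k \<noteq> 0" for k using elim by (intro mpow_nonzero ray_nonzero)
      \<comment> \<open>Weight 1 at j makes the extra factor exactly i \<rho>, and division by it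
        turns an imaginary part into a real part.\<close>
      have "mpow (ray w \<rho>) m = mpow (ray w \<rho>) m1 * (\<i> * of_real \<rho>)"
        by (subst m_eq) (simp add: mpow_add mpow_single ray_def w)
      then have "(TA (ray w \<rho>) / ?X \<rho> / mpow (ray w \<rho>) m) / (TB (ray w \<rho>) / ?X \<rho> / mpow (ray w \<rho>) m1) =
          TA (ray w \<rho>) / TB (ray w \<rho>) / (\<i> * of_real \<rho>)"
        using nz elim by (simp add: field_simps)
      with elim(1) have "Re (TA (ray w \<rho>) / TB (ray w \<rho>) / (\<i> * of_real \<rho>)) > 0" by simp
      moreover have "Re (z / (\<i> * of_real \<rho>)) = Im z / \<rho>" for z
        using elim(2) by (simp add: Re_divide power2_eq_square)
      ultimately have "Im (TA (ray w \<rho>) / TB (ray w \<rho>)) / \<rho> > 0" by (simp only:)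
      then show ?case using elim(2) by (simp add: zero_less_divide_iff)
    qed
    then obtain \<rho> where "\<rho> > 0" "Im (TA (ray w \<rho>) / TB (ray w \<rho>)) > 0"
      using eventually_happens'[OF trivial_limit_at_top_linorder] by blast
    then show thesis by (intro that[of "ray w \<rho>"] Im_ray_pos)
  qed
  have Qpos: "Im (TA x / TB x) > 0" if x: "\<And>v. Im (x v) > 0" for x
  proof (rule ccontr)
    assume neg: "\<not> Im (TA x / TB x) > 0"
    define l where "l t v = of_real (1 - t) * x0 v + of_real t * x v" for t v
    have Iml: "Im (l t v) > 0" if "t \<in> {0..1}" for t v
    proof -
      have "0 < (1 - t) * Im (x0 v) + t * Im (x v)"
      proof (cases "t = 0")
        case False
        then show ?thesis using that x[of v] x0(1)[of v] by (intro add_nonneg_pos) auto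
      qed (simp add: x0)
      then show ?thesis by (simp add: l_def)
    qed
    have "continuous_on {0..1} (\<lambda>t. Im (TA (l t) / TB (l t)))"
      unfolding TA_def TB_def
      using TB0[OF Iml] unfolding l_def TB_def
      by (intro continuous_intros continuous_on_peval) auto
    moreover have "l 1 = x" "l 0 = x0" by (auto simp: l_def)
    then have "Im (TA (l 1) / TB (l 1)) \<le> 0" "0 \<le> Im (TA (l 0) / TB (l 0))"
      using neg x0(2) by auto
    ultimately obtain t where "0 \<le> t" "t \<le> 1" "Im (TA (l t) / TB (l t)) = 0"
      using IVT2'[of "\<lambda>t. Im (TA (l t) / TB (l t))" 1 0 0] by auto
    with Q[of "l t"] Iml show False by auto
  qed
  define yy where "yy v = of_real (\<mu> v) * y v" for v
  have Imy: "Im (yy v) > 0" for v using sc(1)[of v] y by (simp add: yy_def)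
  have "h = A + pconst \<i> * B"
    by (rule poly_mapping_eqI) (simp add: A_def B_def lookup_add coef_pconst_mult complex_eq_iff)
  then have "peval (weyl_op a h) yy = TA yy + \<i> * TB yy"
    by (simp add: weyl_op_add weyl_op_pconst_mult peval_add peval_mult TA_def TB_def)
  also have "\<dots> = TB yy * (TA yy / TB yy + \<i>)" using TB0[of yy, OF Imy] by (simp add: field_simps)
  also have "\<dots> \<noteq> 0"
  proof -
    have "Im (TA yy / TB yy + \<i>) > 0" using Qpos[of yy, OF Imy] by simp
    then have "TA yy / TB yy + \<i> \<noteq> 0" by (metis less_irrefl zero_complex.sel(2))
    then show ?thesis using TB0[of yy, OF Imy] by simp
  qed
  finally show "peval (weyl_op (wscale \<mu> lam a) g) y \<noteq> 0"
    unfolding peval_weyl_op_wscale h_def c_def u_def yy_def .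
qed

subsection \<open>Limits of stable polynomials\<close>

text \<open>The common finite support bounds the degrees. Coefficientwise convergence then survives
  products and gives uniform convergence on compact sets.\<close>

definition coef_tendsto :: "(nat \<Rightarrow> 'k \<Rightarrow>\<^sub>0 complex) \<Rightarrow> ('k \<Rightarrow>\<^sub>0 complex) \<Rightarrow> bool"
  where "coef_tendsto p q \<longleftrightarrow>
    (\<exists>S. finite S \<and> (\<forall>n. supp (p n) \<subseteq> S)) \<and> (\<forall>m. (\<lambda>n. coef (p n) m) \<longlonglongrightarrow> coef q m)"

lemma coef_tendsto_limit_supp:
  fixes q :: "'k \<Rightarrow>\<^sub>0 complex"
  assumes "\<And>n. supp (p n) \<subseteq> S" "\<And>m. (\<lambda>n. coef (p n) m) \<longlonglongrightarrow> coef q m"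
  shows "supp q \<subseteq> S"
proof
  fix m assume m: "m \<in> supp q"
  show "m \<in> S"
  proof (rule ccontr)
    assume "m \<notin> S"
    then have "coef (p n) m = 0" for n using assms(1)[of n] by (auto simp: in_keys_iff)
    with assms(2)[of m] have "(\<lambda>_. 0) \<longlonglongrightarrow> coef q m" by simp
    then have "coef q m = 0" by (rule LIMSEQ_unique[OF _ tendsto_const])
    with m show False by (simp add: in_keys_iff)
  qed
qed

lemma coef_tendsto_const: "coef_tendsto (\<lambda>_. p) p"
  unfolding coef_tendsto_def by (intro conjI exI[of _ "supp p"]) auto

lemma coef_tendsto_add:
  assumes "coef_tendsto p q" "coef_tendsto p' q'"
  shows "coef_tendsto (\<lambda>n. p n + p' n) (q + q')"
proof -
  obtain S S' where S: "finite S" "\<And>n. supp (p n) \<subseteq> S" "finite S'" "\<And>n. supp (p' n) \<subseteq> S'"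
    using assms unfolding coef_tendsto_def by blast
  have "supp (p n + p' n) \<subseteq> S \<union> S'" for n using keys_add[of "p n" "p' n"] S by blast
  moreover have "(\<lambda>n. coef (p n + p' n) m) \<longlonglongrightarrow> coef (q + q') m" for m
    unfolding lookup_add using assms by (intro tendsto_add) (auto simp: coef_tendsto_def)
  ultimately show ?thesis unfolding coef_tendsto_def using S by (meson finite_UnI)
qed

lemma coef_tendsto_sum:
  "(\<And>i. i \<in> A \<Longrightarrow> coef_tendsto (p i) (q i)) \<Longrightarrow>
    coef_tendsto (\<lambda>n. \<Sum>i\<in>A. p i n) (\<Sum>i\<in>A. q i)"
  by (induction A rule: infinite_finite_induct) (simp_all add: coef_tendsto_const coef_tendsto_add)

lemma coef_tendsto_mult:
  fixes q q' :: "'v cpoly"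
  assumes "coef_tendsto p q" "coef_tendsto p' q'"
  shows "coef_tendsto (\<lambda>n. p n * p' n) (q * q')"
proof -
  obtain S S' where S: "finite S" "\<And>n. supp (p n) \<subseteq> S" "finite S'" "\<And>n. supp (p' n) \<subseteq> S'"
    using assms unfolding coef_tendsto_def by blast
  have lim: "(\<lambda>n. coef (p n) m) \<longlonglongrightarrow> coef q m" "(\<lambda>n. coef (p' n) m) \<longlonglongrightarrow> coef q' m" for m
    using assms unfolding coef_tendsto_def by blast+
  have "supp (p n * p' n) \<subseteq> (\<lambda>(a, b). a + b) ` (S \<times> S')" for n
    using keys_mult[of "p n" "p' n"] S by fast
  moreover have "finite ((\<lambda>(a, b). a + b) ` (S \<times> S'))" using S by simp
  moreover have "(\<lambda>n. coef (p n * p' n) m) \<longlonglongrightarrow> coef (q * q') m" for m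
  proof -
    have q: "supp q \<subseteq> S" "supp q' \<subseteq> S'"
      by (rule coef_tendsto_limit_supp[OF S(2) lim(1)], rule coef_tendsto_limit_supp[OF S(4) lim(2)])
    have if_tendsto: "(\<lambda>n. if P then f n else (0::complex)) \<longlonglongrightarrow> (if P then l else 0)"
      if "f \<longlonglongrightarrow> l" for P f l
      using that by (cases P) auto
    show ?thesis
      unfolding coef_mult[OF S(1,3) q] coef_mult[OF S(1,3) S(2,4)]
      by (intro tendsto_sum if_tendsto tendsto_mult lim)
  qed
  ultimately show ?thesis unfolding coef_tendsto_def by blast
qed

lemma coef_tendsto_power:
  fixes q :: "'v cpoly"
  shows "coef_tendsto p q \<Longrightarrow> coef_tendsto (\<lambda>n. p n ^ k) (q ^ k)"
  by (induction k) (simp_all add: coef_tendsto_const coef_tendsto_mult)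

lemma coef_tendsto_prod:
  fixes q :: "'i \<Rightarrow> 'v cpoly"
  shows "(\<And>i. i \<in> A \<Longrightarrow> coef_tendsto (p i) (q i)) \<Longrightarrow>
    coef_tendsto (\<lambda>n. \<Prod>i\<in>A. p i n) (\<Prod>i\<in>A. q i)"
  by (induction A rule: infinite_finite_induct) (simp_all add: coef_tendsto_const coef_tendsto_mult)

lemma coef_tendsto_pconst: "c \<longlonglongrightarrow> d \<Longrightarrow> coef_tendsto (\<lambda>n. pconst (c n)) (pconst d)"
  unfolding coef_tendsto_def pconst_def
proof (intro conjI allI exI[of _ "{0}"])
  fix m assume "c \<longlonglongrightarrow> d"
  then show "(\<lambda>n. coef (Poly_Mapping.single 0 (c n)) m) \<longlonglongrightarrow> coef (Poly_Mapping.single 0 d) m"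
    by (cases "m = 0") (auto simp: lookup_single when_def)
qed auto

lemma coef_tendsto_pderiv_multi:
  assumes "coef_tendsto p q"
  shows "coef_tendsto (\<lambda>n. pderiv_multi \<beta> (p n)) (pderiv_multi \<beta> q)"
proof -
  obtain S where S: "finite S" "\<And>n. supp (p n) \<subseteq> S" using assms unfolding coef_tendsto_def by blast
  have "supp (pderiv_multi \<beta> (p n)) \<subseteq> (\<lambda>m. m - \<beta>) ` S" for n
  proof
    fix m assume "m \<in> supp (pderiv_multi \<beta> (p n))"
    then have "m + \<beta> \<in> supp (p n)" unfolding in_keys_iff lookup_pderiv_multi by simp
    then have "m + \<beta> \<in> S" using S by blast
    then show "m \<in> (\<lambda>m. m - \<beta>) ` S" by (intro image_eqI[of _ _ "m + \<beta>"]) auto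
  qed
  moreover have "(\<lambda>n. coef (pderiv_multi \<beta> (p n)) m) \<longlonglongrightarrow> coef (pderiv_multi \<beta> q) m" for m
    unfolding lookup_pderiv_multi
    using assms by (intro tendsto_mult tendsto_const) (auto simp: coef_tendsto_def)
  ultimately show ?thesis unfolding coef_tendsto_def using S(1) by blast
qed

lemma coef_tendsto_weyl_op_wscale:
  assumes "coef_tendsto p q" "\<And>v. (\<lambda>n. \<mu> n v) \<longlonglongrightarrow> \<mu>' v" "\<And>v. (\<lambda>n. lam n v) \<longlonglongrightarrow> lam' v"
  shows "coef_tendsto (\<lambda>n. weyl_op (wscale (\<mu> n) (lam n) a) (p n)) (weyl_op (wscale \<mu>' lam' a) q)"
  unfolding weyl_op_wscale mpow_def
  by (intro coef_tendsto_sum coef_tendsto_mult coef_tendsto_pconst coef_tendsto_const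
      coef_tendsto_pderiv_multi assms tendsto_intros)

lemma uniform_limit_finite_sum:
  fixes f :: "'i \<Rightarrow> 'n \<Rightarrow> 'x \<Rightarrow> 'b::real_normed_vector"
  assumes "\<And>i. i \<in> A \<Longrightarrow> uniform_limit K (f i) (g i) F"
  shows "uniform_limit K (\<lambda>n x. \<Sum>i\<in>A. f i n x) (\<lambda>x. \<Sum>i\<in>A. g i x) F"
  using assms
  by (induction A rule: infinite_finite_induct) (simp_all add: uniform_limit_const uniform_limit_add)

text \<open>Hurwitz's theorem is univariate, so it is applied on the complex line through a supposed
  zero z0 and a point z1 with q(z1) \<noteq> 0. The parameters that keep the line in the upper half
  space form an open convex set containing 0 and 1, and q is not constant on it.\<close>

lemma stable_limit:
  fixes p :: "nat \<Rightarrow> 'v::finite cpoly"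
  assumes lim: "coef_tendsto p q" and stable: "\<And>n. stable (p n)" and "q \<noteq> 0"
  shows "stable q"
  unfolding stable_def
proof (intro allI impI notI)
  fix z0 :: "'v \<Rightarrow> complex" assume z0: "\<forall>v. Im (z0 v) > 0" and zero: "peval q z0 = 0"
  obtain z1 where z1: "\<And>v. Im (z1 v) > 0" "peval q z1 \<noteq> 0"
    using peval_nonzero_upper[OF \<open>q \<noteq> 0\<close>] by blast
  obtain S where S: "finite S" "\<And>n. supp (p n) \<subseteq> S" using lim unfolding coef_tendsto_def by blast
  have lim': "(\<lambda>n. coef (p n) m) \<longlonglongrightarrow> coef q m" for m using lim unfolding coef_tendsto_def by blast
  have Sq: "supp q \<subseteq> S" by (rule coef_tendsto_limit_supp[OF S(2) lim'])
  define l where "l t v = z0 v + t * (z1 v - z0 v)" for t v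
  define D where "D = {t. \<forall>v. 0 < Im (l t v)}"
  have hol: "(\<lambda>t. peval f (l t)) holomorphic_on A" for f A
    unfolding peval_mpow mpow_def l_def by (intro holomorphic_intros)
  have "peval q (l 0) \<noteq> 0"
  proof (rule Hurwitz_no_zeros[of D "\<lambda>n t. peval (p n) (l t)" "\<lambda>t. peval q (l t)" 0])
    have "D = (\<Inter>v. {t. 0 < Im (l t v)})" by (auto simp: D_def)
    also have "open \<dots>"
      unfolding l_def by (intro open_INT ballI open_Collect_less continuous_intros finite)
    finally show "open D" .
    have "convex D"
    proof (rule convexI)
      fix s t :: complex and a b :: real
      assume *: "s \<in> D" "t \<in> D" "0 \<le> a" "0 \<le> b" "a + b = 1"
      have "Im (l (a *\<^sub>R s + b *\<^sub>R t) v) > 0" for v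
      proof -
        have "z0 v = of_real (a + b) * z0 v" using *(5) by simp
        then have "l (a *\<^sub>R s + b *\<^sub>R t) v = a *\<^sub>R l s v + b *\<^sub>R l t v"
          by (simp add: l_def scaleR_conv_of_real algebra_simps)
        moreover have "0 < a * Im (l s v) + b * Im (l t v)"
        proof (cases "a = 0")
          case True
          with *(5) have b: "b = 1" by simp
          show ?thesis unfolding True b using *(2) by (simp add: D_def)
        next
          case False
          then have "0 < a * Im (l s v)" using * by (simp add: D_def)
          moreover have "0 \<le> b * Im (l t v)" using *(2,4)
            by (intro mult_nonneg_nonneg) (auto simp: D_def less_imp_le)
          ultimately show ?thesis by simp
        qed
        ultimately show ?thesis by simp
      qed
      then show "a *\<^sub>R s + b *\<^sub>R t \<in> D" by (simp add: D_def)
    qed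
    then show "connected D" by (rule convex_connected)
    show "(\<lambda>t. peval (p n) (l t)) holomorphic_on D" for n by (rule hol)
    show "(\<lambda>t. peval q (l t)) holomorphic_on D" by (rule hol)
    show "uniform_limit K (\<lambda>n t. peval (p n) (l t)) (\<lambda>t. peval q (l t)) sequentially"
      if K: "compact K" "K \<subseteq> D" for K
    proof -
      have "uniform_limit K (\<lambda>n t. \<Sum>m\<in>S. coef (p n) m * mpow (l t) m)
          (\<lambda>t. \<Sum>m\<in>S. coef q m * mpow (l t) m) sequentially"
      proof (rule uniform_limit_finite_sum)
        fix m
        have "continuous_on K (\<lambda>t. mpow (l t) m)"
          unfolding mpow_def l_def by (intro continuous_intros)
        then have "bounded ((\<lambda>t. mpow (l t) m) ` K)"
          by (intro compact_imp_bounded compact_continuous_image K)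
        then obtain B where B: "\<And>t. t \<in> K \<Longrightarrow> norm (mpow (l t) m) \<le> B"
          unfolding bounded_iff by blast
        have "(\<lambda>n. norm (coef (p n) m - coef q m) * \<bar>B\<bar>) \<longlonglongrightarrow> 0 * \<bar>B\<bar>"
          using lim'[of m] by (intro tendsto_mult tendsto_const tendsto_norm_zero) (simp add: LIM_zero_iff)
        then have tend: "(\<lambda>n. norm (coef (p n) m - coef q m) * \<bar>B\<bar>) \<longlonglongrightarrow> 0" by simp
        show "uniform_limit K (\<lambda>n t. coef (p n) m * mpow (l t) m) (\<lambda>t. coef q m * mpow (l t) m) sequentially"
        proof (rule uniform_limitI)
          fix e :: real assume "e > 0"
          with tend have "eventually (\<lambda>n. norm (coef (p n) m - coef q m) * \<bar>B\<bar> < e) sequentially"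
            by (rule order_tendstoD)
          then show "eventually (\<lambda>n. \<forall>t\<in>K. dist (coef (p n) m * mpow (l t) m) (coef q m * mpow (l t) m) < e) sequentially"
          proof eventually_elim
            case (elim n)
            show ?case
            proof
              fix t assume "t \<in> K"
              have "dist (coef (p n) m * mpow (l t) m) (coef q m * mpow (l t) m) =
                  norm (coef (p n) m - coef q m) * norm (mpow (l t) m)"
                by (simp add: dist_norm norm_mult flip: left_diff_distrib)
              also have "\<dots> \<le> norm (coef (p n) m - coef q m) * \<bar>B\<bar>"
                using B[OF \<open>t \<in> K\<close>] by (intro mult_left_mono) auto
              finally show "dist (coef (p n) m * mpow (l t) m) (coef q m * mpow (l t) m) < e"
                using elim by simp
            qed
          qed
        qed
      qed
      then show ?thesis by (simp add: peval_superset[OF S] peval_superset[OF S(1) Sq])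
    qed
    have l01: "l 0 = z0" "l 1 = z1" by (auto simp: l_def)
    then have D01: "0 \<in> D" "1 \<in> D" using z0 z1 by (auto simp: D_def)
    then show "0 \<in> D" by simp
    show "\<not> (\<lambda>t. peval q (l t)) constant_on D"
      unfolding constant_on_def using D01 z1(2) zero l01 by metis
    show "peval (p n) (l t) \<noteq> 0" if "t \<in> D" for n t
      using that by (intro stableD[OF stable]) (simp add: D_def)
  qed
  moreover have "l 0 = z0" by (auto simp: l_def)
  ultimately show False using zero by simp
qed

subsection \<open>Perturbation\<close>

definition perturb :: "real \<Rightarrow> ('v::finite \<Rightarrow>\<^sub>0 nat) \<Rightarrow> 'v cpoly"
  where "perturb s N = (\<Prod>v\<in>UNIV. (1 + pconst (of_real s) * pvar v) ^ coef N v)"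

lemma peval_perturb: "peval (perturb s N) x = (\<Prod>v\<in>UNIV. (1 + of_real s * x v) ^ coef N v)"
  by (simp add: perturb_def peval_prod peval_power peval_add peval_mult)

lemma real_coeffs_perturb: "real_coeffs (perturb s N)"
  unfolding perturb_def
  by (intro real_coeffs_prod real_coeffs_power real_coeffs_add real_coeffs_mult real_coeffs_1
      real_coeffs_pconst real_coeffs_pvar) auto

lemma coef_tendsto_perturb:
  assumes "s \<longlonglongrightarrow> 0"
  shows "coef_tendsto (\<lambda>n. perturb (s n) N) 1"
proof -
  have "(\<lambda>n. complex_of_real (s n)) \<longlonglongrightarrow> of_real 0" by (intro tendsto_of_real assms)
  then have "coef_tendsto (\<lambda>n. perturb (s n) N)
    (\<Prod>v\<in>UNIV. (1 + pconst (of_real 0) * pvar v) ^ coef N v)"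
    unfolding perturb_def
    by (intro coef_tendsto_prod coef_tendsto_power coef_tendsto_add coef_tendsto_mult
        coef_tendsto_const coef_tendsto_pconst)
  then show ?thesis by (simp add: pconst_def)
qed

lemma stable_mult: "stable f \<Longrightarrow> stable g \<Longrightarrow> stable (f * g)"
  by (simp add: stable_def peval_mult)

lemma stable_perturb:
  assumes "s > 0"
  shows "stable (perturb s N)"
  unfolding stable_def peval_perturb
proof (intro allI impI)
  fix z :: "'a \<Rightarrow> complex" assume z: "\<forall>v. Im (z v) > 0"
  have "1 + of_real s * z v \<noteq> 0" for v
  proof -
    have "Im (1 + of_real s * z v) > 0" using z assms by simp
    then show ?thesis by (metis less_irrefl zero_complex.sel(2))
  qed
  then show "(\<Prod>v\<in>UNIV. (1 + of_real s * z v) ^ coef N v) \<noteq> 0" by simp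
qed

text \<open>Each linear factor has a larger imaginary part in modulus, with the same real part, at z
  + ib than at z - ib, because both Im z and b are positive.\<close>

lemma perturb_norm_conj_less:
  assumes "s > 0" "\<And>v. Im (z v) > 0" "\<And>v. b v > 0" "\<And>v. coef N v > 0"
  shows "norm (peval (perturb s N) (\<lambda>v. z v - \<i> * of_real (b v))) <
    norm (peval (perturb s N) (\<lambda>v. z v + \<i> * of_real (b v)))"
proof -
  have lt: "norm (1 + of_real s * (z v - \<i> * of_real (b v))) < norm (1 + of_real s * (z v + \<i> * of_real (b v)))" for v
  proof -
    have "(s * (Im (z v) - b v))\<^sup>2 < (s * (Im (z v) + b v))\<^sup>2"
    proof -
      have "s * (Im (z v) * (s * b v)) > 0" using assms(1) assms(2)[of v] assms(3)[of v] by simp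
      then show ?thesis by (simp add: power2_eq_square algebra_simps)
    qed
    then show ?thesis by (simp add: cmod_def algebra_simps)
  qed
  have pw: "norm (1 + of_real s * (z v - \<i> * of_real (b v))) ^ coef N v <
      norm (1 + of_real s * (z v + \<i> * of_real (b v))) ^ coef N v" for v
    using lt[of v] assms(4)[of v] by (intro power_strict_mono) auto
  show ?thesis
    unfolding peval_perturb prod_norm[symmetric] norm_power
    \<comment> \<open>Every factor is strictly smaller, so any index can witness strictness;
      \<open>undefined\<close> merely names one.\<close>
    using pw by (intro prod_mono_strict[of undefined])
      (auto intro: less_imp_le le_less_trans[OF zero_le_power[OF norm_ge_zero] pw])
qed

section \<open>Leading terms of perturbed polynomials\<close>

definition strict_lead :: "('v::finite \<Rightarrow> nat) \<Rightarrow> ('v \<Rightarrow>\<^sub>0 nat) \<Rightarrow> 'v cpoly \<Rightarrow> bool"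
  where "strict_lead w m f \<longleftrightarrow> lead w m f \<and> coef f m \<noteq> 0"

lemma strict_lead_1: "strict_lead w 0 1"
  by (simp add: strict_lead_def lead_def lookup_one)

text \<open>Weighted degrees add, so only the product of the two leading terms attains the maximum
  and nothing can cancel it.\<close>

lemma strict_lead_mult:
  assumes "strict_lead w m f" "strict_lead w m' g"
  shows "strict_lead w (m + m') (f * g)"
proof -
  have le: "wdeg w k < wdeg w m \<or> k = m" if "k \<in> supp f" for k
    using that assms(1) by (auto simp: strict_lead_def lead_def)
  have le': "wdeg w k < wdeg w m' \<or> k = m'" if "k \<in> supp g" for k
    using that assms(2) by (auto simp: strict_lead_def lead_def)
  have "lead w (m + m') (f * g)"
    unfolding lead_def
  proof (intro ballI impI)
    fix k assume "k \<in> supp (f * g)" "k \<noteq> m + m'"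
    then obtain k1 k2 where "k1 \<in> supp f" "k2 \<in> supp g" "k = k1 + k2"
      using keys_mult[of f g] by blast
    then show "wdeg w k < wdeg w (m + m')"
      using le[of k1] le'[of k2] \<open>k \<noteq> m + m'\<close> by (auto simp: wdeg_add)
  qed
  moreover have "coef (f * g) (m + m') = coef f m * coef g m'"
  proof -
    have "coef (f * g) (m + m') =
        (\<Sum>k\<in>supp f. \<Sum>k'\<in>supp g. if k + k' = m + m' then coef f k * coef g k' else 0)"
      by (rule coef_mult) auto
    also have "\<dots> = (\<Sum>k'\<in>supp g. if m + k' = m + m' then coef f m * coef g k' else 0)"
    proof (rule sum_eq_single)
      fix k assume k: "k \<in> supp f" "k \<noteq> m"
      show "(\<Sum>k'\<in>supp g. if k + k' = m + m' then coef f k * coef g k' else 0) = 0"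
      proof (rule sum.neutral, intro ballI)
        fix k' assume "k' \<in> supp g"
        then have "wdeg w (k + k') < wdeg w (m + m')"
          using le[OF k(1)] k(2) le'[of k'] by (auto simp: wdeg_add)
        then show "(if k + k' = m + m' then coef f k * coef g k' else 0) = 0" by auto
      qed
    qed (auto simp: in_keys_iff intro!: sum.neutral)
    also have "\<dots> = coef f m * coef g m'"
      by (subst sum_eq_single[of _ m']) (auto simp: in_keys_iff)
    finally show ?thesis .
  qed
  ultimately show ?thesis using assms by (simp add: strict_lead_def)
qed

lemma strict_lead_perturb:
  assumes "s \<noteq> 0" "\<And>v. w v \<ge> 1"
  shows "strict_lead w N (perturb s N)"
proof -
  have lin: "strict_lead w (Poly_Mapping.single v 1) (1 + pconst (of_real s) * pvar v)" for v
  proof -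
    have c: "coef (1 + pconst (of_real s) * pvar v) m =
        (if m = 0 then 1 else if m = Poly_Mapping.single v 1 then of_real s else 0)" for m
    proof -
      have "Poly_Mapping.single v (1::nat) \<noteq> 0" by (metis lookup_single_eq lookup_zero zero_neq_one)
      then show ?thesis
        by (auto simp: lookup_add coef_pconst_mult pvar_def lookup_single lookup_one when_def)
    qed
    have "Poly_Mapping.single v (1::nat) \<noteq> 0" by (metis lookup_single_eq lookup_zero zero_neq_one)
    moreover have "wdeg w 0 < wdeg w (Poly_Mapping.single v 1)"
      using assms(2)[of v] by (simp add: wdeg_single) (simp add: wdeg_def)
    moreover have "m' = 0 \<or> m' = Poly_Mapping.single v 1"
      if "m' \<in> supp (1 + pconst (of_real s) * pvar v)" for m'
      using that c[of m'] unfolding in_keys_iff by presburger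
    ultimately show ?thesis
      using assms(1) c[of "Poly_Mapping.single v 1"] unfolding strict_lead_def lead_def by auto
  qed
  have pow: "strict_lead w (Poly_Mapping.single v k) ((1 + pconst (of_real s) * pvar v) ^ k)" for v k
  proof (induction k)
    case (Suc k)
    have "Poly_Mapping.single v (Suc k) = Poly_Mapping.single v 1 + Poly_Mapping.single v k"
      by (simp flip: single_add)
    then show ?case using strict_lead_mult[OF lin Suc] by simp
  qed (simp add: strict_lead_1)
  have *: "strict_lead w (\<Sum>v\<in>A. Poly_Mapping.single v (coef N v))
      (\<Prod>v\<in>A. (1 + pconst (of_real s) * pvar v) ^ coef N v)" if "finite A" for A
    using that by (induction A rule: finite_induct) (auto intro: strict_lead_1 strict_lead_mult pow)
  have "(\<Sum>v\<in>UNIV. Poly_Mapping.single v (coef N v)) = N"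
    by (rule poly_mapping_eqI) (simp add: lookup_sum lookup_single when_def)
  with *[of UNIV] show ?thesis by (simp add: perturb_def)
qed

lemma stable_nonzero: "stable f \<Longrightarrow> f \<noteq> 0"
  using stableD[of f "\<lambda>_. \<i>"] by auto

text \<open>None of the data depends on s, so one choice serves the whole limit. N is the difference
  between a good exponent m and the leading exponent of f; as m is larger in every coordinate, every
  factor 1 + s x_v occurs, as strictness requires, and m can be lowered at j.\<close>

lemma ex_perturbation:
  fixes a :: "'v::finite weyl_coeffs" and f :: "'v cpoly"
  assumes "a \<noteq> 0" "f \<noteq> 0"
  shows "\<exists>(w :: 'v \<Rightarrow> nat) j k0 m N.
    w j = 1 \<and> (\<forall>v. v \<noteq> j \<longrightarrow> w v \<ge> 2) \<and> dominant w a k0 \<and> (\<forall>v. coef N v > 0) \<and> coef m j \<ge> 1 \<and>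
    top_factor a k0 (\<lambda>v. of_nat (coef m v)) \<noteq> 0 \<and>
    (real_coeffs a \<longrightarrow> (\<exists>r>0. top_factor a k0 (\<lambda>v. of_nat (coef m v)) =
       of_real r * top_factor a k0 (\<lambda>v. of_nat (coef (m - Poly_Mapping.single j 1) v)))) \<and>
    (\<forall>s. s \<noteq> 0 \<longrightarrow> strict_lead w m (f * perturb s N))"
proof -
  obtain L where L: "\<forall>m\<in>supp f \<union> fst ` supp a \<union> snd ` supp a. \<forall>v. coef m v \<le> L"
    using ex_coef_bound[of "supp f \<union> fst ` supp a \<union> snd ` supp a"] by auto
  obtain w :: "'v \<Rightarrow> nat" and j where w: "separating (2 * L) w" "w j = 1" "\<And>v. v \<noteq> j \<Longrightarrow> w v \<ge> 2"
    using ex_separating[of "2 * L"] by blast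
  have w1: "w v \<ge> 1" for v using w(2) w(3)[of v] by (cases "v = j") simp_all
  obtain m0 where m0: "m0 \<in> supp f" "lead w m0 f"
  proof (rule ex_lead[OF w(1) _ assms(2)])
    fix m v assume "m \<in> supp f"
    with L have "coef m v \<le> L" by blast
    then show "coef m v \<le> 2 * L" by simp
  qed
  obtain k0 where k0: "dominant w a k0"
    using ex_dominant[OF w(1) _ assms(1)] L by blast
  have "\<exists>m. (\<forall>v. coef m v > coef m0 v) \<and> top_factor a k0 (\<lambda>v. of_nat (coef m v)) \<noteq> 0 \<and>
    (real_coeffs a \<longrightarrow> (\<exists>r>0. top_factor a k0 (\<lambda>v. of_nat (coef m v)) =
       of_real r * top_factor a k0 (\<lambda>v. of_nat (coef (m - Poly_Mapping.single j 1) v))))"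
  proof (rule ex_good_exponent[OF w(1) w1])
    fix k v assume "k \<in> supp a"
    with L have "coef (snd k) v \<le> L" by blast
    then show "coef (snd k) v \<le> 2 * L" by simp
  next
    show "k0 \<in> supp a" using k0 by (simp add: dominant_def)
  qed
  then obtain m where m: "\<forall>v. coef m v > coef m0 v" "top_factor a k0 (\<lambda>v. of_nat (coef m v)) \<noteq> 0"
    "real_coeffs a \<longrightarrow> (\<exists>r>0. top_factor a k0 (\<lambda>v. of_nat (coef m v)) =
       of_real r * top_factor a k0 (\<lambda>v. of_nat (coef (m - Poly_Mapping.single j 1) v)))"
    by blast
  have m_eq: "m0 + (m - m0) = m"
    using m(1) by (intro poly_mapping_eqI) (simp add: lookup_add lookup_minus less_imp_le)
  have f0: "strict_lead w m0 f" using m0 by (simp add: strict_lead_def in_keys_iff)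
  have "strict_lead w m (f * perturb s (m - m0))" if "s \<noteq> 0" for s
    using strict_lead_mult[OF f0 strict_lead_perturb[where N = "m - m0", OF that w1]] by (simp only: m_eq)
  moreover have "\<forall>v. coef (m - m0) v > 0" using m(1) by (simp add: lookup_minus)
  moreover have "coef m j \<ge> 1" using m(1)[rule_format, of j] by simp
  ultimately show ?thesis using w(2,3) k0 m(2,3)
    by (intro exI[of _ w] exI[of _ j] exI[of _ k0] exI[of _ m] exI[of _ "m - m0"] conjI) simp_all
qed

section \<open>Passage to all scalars in the closed cube\<close>

lemma stable_wscale_limit:
  fixes a :: "'v::finite weyl_coeffs"
  assumes approx: "\<And>s \<mu> lam. 0 < s \<Longrightarrow> (\<And>v. 0 < \<mu> v) \<Longrightarrow> (\<And>v. 0 < lam v) \<Longrightarrow>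
      (\<And>v. lam v * \<mu> v < 1) \<Longrightarrow> stable (weyl_op (wscale \<mu> lam a) (f * perturb s N))"
    and sc: "\<And>v. \<mu> v \<in> {0..1}" "\<And>v. lam v \<in> {0..1}"
    and nz: "weyl_op (wscale \<mu> lam a) f \<noteq> 0"
  shows "stable (weyl_op (wscale \<mu> lam a) f)"
proof (rule stable_limit)
  define s where "s n = inverse (real (Suc n))" for n
  \<comment> \<open>Moving by the proportion \<open>s n\<close> towards 1/2 maps [0,1] into (0,1),
    so the scalars are positive with product below 1. The same null sequence drives the
    perturbation.\<close>
  define avg where "avg n x = x + s n * (1 / 2 - x)" for n and x :: real
  have s: "0 < s n" "s n \<le> 1" for n by (simp_all add: s_def inverse_le_1_iff)
  have s0: "s \<longlonglongrightarrow> 0" unfolding s_def by (rule LIMSEQ_inverse_real_of_nat)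
  have avg: "0 < avg n x \<and> avg n x < 1" if "x \<in> {0..1}" for n x
  proof -
    have eq: "avg n x = (1 - s n) * x + s n / 2" by (simp add: avg_def algebra_simps)
    have "0 \<le> (1 - s n) * x" using s[of n] that by simp
    moreover have "(1 - s n) * x \<le> (1 - s n) * 1"
      using s[of n] that by (intro mult_left_mono) auto
    ultimately show ?thesis using s[of n] unfolding eq by simp
  qed
  have lim: "(\<lambda>n. avg n x) \<longlonglongrightarrow> x" for x
  proof -
    have "(\<lambda>n. x + s n * (1 / 2 - x)) \<longlonglongrightarrow> x + 0 * (1 / 2 - x)" by (intro tendsto_intros s0)
    then show ?thesis by (simp add: avg_def)
  qed
  have "coef_tendsto (\<lambda>n. f * perturb (s n) N) (f * 1)"
    by (intro coef_tendsto_mult coef_tendsto_const coef_tendsto_perturb s0)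
  then show "coef_tendsto (\<lambda>n. weyl_op (wscale (\<lambda>v. avg n (\<mu> v)) (\<lambda>v. avg n (lam v)) a) (f * perturb (s n) N))
    (weyl_op (wscale \<mu> lam a) f)"
    by (intro coef_tendsto_weyl_op_wscale lim) simp
  show "stable (weyl_op (wscale (\<lambda>v. avg n (\<mu> v)) (\<lambda>v. avg n (lam v)) a) (f * perturb (s n) N))" for n
  proof (rule approx)
    fix v
    show "0 < avg n (\<mu> v)" "0 < avg n (lam v)" using avg sc by auto
    have "avg n (lam v) * avg n (\<mu> v) < 1 * 1"
      using avg[OF sc(1)[of v], of n] avg[OF sc(2)[of v], of n] by (intro mult_strict_mono) auto
    then show "avg n (lam v) * avg n (\<mu> v) < 1" by simp
  qed (rule s)
qed (rule nz)

lemma wscale_preserves_stable: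
  fixes a :: "'v::finite weyl_coeffs"
  assumes pres: "\<And>h. stable h \<Longrightarrow> stable (weyl_op a h) \<or> weyl_op a h = 0"
    and sc: "\<And>v. \<mu> v \<in> {0..1}" "\<And>v. lam v \<in> {0..1}"
    and f: "stable f" and nz: "weyl_op (wscale \<mu> lam a) f \<noteq> 0"
  shows "stable (weyl_op (wscale \<mu> lam a) f)"
proof -
  have "wscale \<mu> lam a \<noteq> 0" using nz by (auto simp: weyl_op_0)
  then have "a \<noteq> 0" using supp_wscale[of \<mu> lam a] by auto
  from ex_perturbation[OF this stable_nonzero[OF f]]
  obtain w :: "'v \<Rightarrow> nat" and j k0 m N where *: "w j = 1" "\<forall>v. v \<noteq> j \<longrightarrow> w v \<ge> 2" "dominant w a k0"
    "top_factor a k0 (\<lambda>v. of_nat (coef m v)) \<noteq> 0"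
    "\<forall>s. s \<noteq> 0 \<longrightarrow> strict_lead w m (f * perturb s N)" by blast
  have w1: "w v \<ge> 1" for v using *(1) *(2)[rule_format, of v] by (cases "v = j") simp_all
  show ?thesis
  proof (rule stable_wscale_limit[OF _ sc nz])
    fix s :: real and \<mu>' lam' :: "'v \<Rightarrow> real"
    assume s: "0 < s" and sc': "\<And>v. 0 < \<mu>' v" "\<And>v. 0 < lam' v" "\<And>v. lam' v * \<mu>' v < 1"
    have "strict_lead w m (f * perturb s N)" using *(5) s by simp
    then show "stable (weyl_op (wscale \<mu>' lam' a) (f * perturb s N))"
      by (intro stable_wscale[OF pres w1 *(3) stable_mult[OF f stable_perturb[OF s]] _ _ *(4) sc'])
         (auto simp: strict_lead_def)
  qed
qed

lemma wscale_preserves_real_stable: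
  fixes a :: "'v::finite weyl_coeffs"
  assumes pres: "\<And>h. real_stable h \<Longrightarrow> real_stable (weyl_op a h) \<or> weyl_op a h = 0"
    and real: "real_coeffs a"
    and sc: "\<And>v. \<mu> v \<in> {0..1}" "\<And>v. lam v \<in> {0..1}"
    and f: "real_stable f" and nz: "weyl_op (wscale \<mu> lam a) f \<noteq> 0"
  shows "real_stable (weyl_op (wscale \<mu> lam a) f)"
proof -
  have fs: "stable f" "real_coeffs f" using f by (auto simp: real_stable_def)
  have "wscale \<mu> lam a \<noteq> 0" using nz by (auto simp: weyl_op_0)
  then have "a \<noteq> 0" using supp_wscale[of \<mu> lam a] by auto
  from ex_perturbation[OF this stable_nonzero[OF fs(1)]]
  obtain w :: "'v \<Rightarrow> nat" and j k0 m N where *: "w j = 1" "\<forall>v. v \<noteq> j \<longrightarrow> w v \<ge> 2" "dominant w a k0"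
    "\<forall>v. coef N v > 0" "coef m j \<ge> 1"
    "top_factor a k0 (\<lambda>v. of_nat (coef m v)) \<noteq> 0"
    "real_coeffs a \<longrightarrow> (\<exists>r>0. top_factor a k0 (\<lambda>v. of_nat (coef m v)) =
       of_real r * top_factor a k0 (\<lambda>v. of_nat (coef (m - Poly_Mapping.single j 1) v)))"
    "\<forall>s. s \<noteq> 0 \<longrightarrow> strict_lead w m (f * perturb s N)" by blast
  from *(7) real obtain r where r: "r > 0" "top_factor a k0 (\<lambda>v. of_nat (coef m v)) =
       of_real r * top_factor a k0 (\<lambda>v. of_nat (coef (m - Poly_Mapping.single j 1) v))" by blast
  have "stable (weyl_op (wscale \<mu> lam a) f)"
  proof (rule stable_wscale_limit[OF _ sc nz])
    fix s :: real and \<mu>' lam' :: "'v \<Rightarrow> real"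
    assume s: "0 < s" and sc': "\<And>v. 0 < \<mu>' v" "\<And>v. 0 < lam' v" "\<And>v. lam' v * \<mu>' v < 1"
    have lead: "lead w m (f * perturb s N)" "coef (f * perturb s N) m \<noteq> 0"
      using *(8) s by (auto simp: strict_lead_def)
    have rs: "real_stable (f * perturb s N)"
      using fs stable_perturb[OF s] real_coeffs_perturb
      by (auto simp: real_stable_def intro: stable_mult real_coeffs_mult)
    show "stable (weyl_op (wscale \<mu>' lam' a) (f * perturb s N))"
    proof (rule real_stable_wscale[OF pres *(1) *(2)[rule_format] *(3) rs lead *(5) _ *(6) r sc'])
      fix z :: "'v \<Rightarrow> complex" and b :: "'v \<Rightarrow> real"
      assume z: "\<And>v. Im (z v) > 0" and b: "\<And>v. b v > 0"
      let ?m = "\<lambda>v. z v - \<i> * of_real (b v)" and ?p = "\<lambda>v. z v + \<i> * of_real (b v)"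
      have "norm (peval f ?m) \<le> norm (peval f ?p)"
        using b by (intro stable_norm_conj_le fs z less_imp_le)
      \<comment> \<open>This keeps the product inequality strict even where f vanishes at
        \<open>?m\<close>.\<close>
      moreover have "norm (peval f ?p) > 0"
        using stableD[OF fs(1), of ?p] z b by (simp add: add_pos_pos)
      moreover have "norm (peval (perturb s N) ?m) < norm (peval (perturb s N) ?p)"
        by (intro perturb_norm_conj_less s z b *(4)[rule_format])
      ultimately show "norm (peval (f * perturb s N) ?m) < norm (peval (f * perturb s N) ?p)"
        unfolding peval_mult norm_mult
        by (meson mult_right_mono mult_strict_left_mono le_less_trans norm_ge_zero)
    qed
  qed
  then show ?thesis
    using real fs by (simp add: real_stable_def real_coeffs_weyl_op real_coeffs_wscale)
qed

subsection \<open>Symbols\<close>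

definition join_exp :: "('n::finite \<Rightarrow>\<^sub>0 nat) \<times> ('n \<Rightarrow>\<^sub>0 nat) \<Rightarrow> ('n + 'n \<Rightarrow>\<^sub>0 nat)"
  where "join_exp k = Abs_poly_mapping (case_sum (coef (fst k)) (coef (snd k)))"

lemma coef_join_exp [simp]:
  "coef (join_exp k) (Inl i) = coef (fst k) i" "coef (join_exp k) (Inr i) = coef (snd k) i"
  by (simp_all add: join_exp_def)

lemma join_exp_inject: "join_exp k = join_exp k' \<longleftrightarrow> k = k'"
proof
  assume eq: "join_exp k = join_exp k'"
  have "fst k = fst k'"
    by (rule poly_mapping_eqI) (metis eq coef_join_exp(1))
  moreover have "snd k = snd k'"
    by (rule poly_mapping_eqI) (metis eq coef_join_exp(2))
  ultimately show "k = k'" by (simp add: prod_eq_iff)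
qed simp

lemma ex_join_exp: "\<exists>k. m = join_exp k"
proof
  show "m = join_exp (Abs_poly_mapping (coef m \<circ> Inl), Abs_poly_mapping (coef m \<circ> Inr))"
  proof (rule poly_mapping_eqI)
    fix v
    show "coef m v = coef (join_exp (Abs_poly_mapping (coef m \<circ> Inl), Abs_poly_mapping (coef m \<circ> Inr))) v"
      by (cases v) simp_all
  qed
qed

lemma prod_Sum_UNIV:
  fixes g :: "'a::finite + 'b::finite \<Rightarrow> 'c::comm_monoid_mult"
  shows "prod g UNIV = (\<Prod>i\<in>UNIV. g (Inl i)) * (\<Prod>i\<in>UNIV. g (Inr i))"
  by (simp add: UNIV_Plus_UNIV[symmetric] prod.Plus del: UNIV_Plus_UNIV)

lemma prod_pvar: "(\<Prod>v\<in>UNIV. pvar v ^ coef m v) = pmonom (m :: 'v::finite \<Rightarrow>\<^sub>0 nat)"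
proof -
  have pow: "pvar v ^ n = pmonom (Poly_Mapping.single v n)" for v :: 'v and n
  proof (induction n)
    case (Suc n)
    then show ?case by (simp add: pvar_def pmonom_def mult_single flip: single_add)
  qed (simp add: pmonom_def)
  have "(\<Prod>v\<in>A. pvar v ^ coef m v) = pmonom (\<Sum>v\<in>A. Poly_Mapping.single v (coef m v))"
    if "finite A" for A
    using that by (induction A rule: finite_induct) (simp_all add: pow pmonom_def mult_single)
  from this[of UNIV] have "(\<Prod>v\<in>UNIV. pvar v ^ coef m v) =
      pmonom (\<Sum>v\<in>UNIV. Poly_Mapping.single v (coef m v))" by simp
  moreover have "(\<Sum>v\<in>UNIV. Poly_Mapping.single v (coef m v)) = m"
    by (rule poly_mapping_eqI) (simp add: lookup_sum lookup_single when_def)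
  ultimately show ?thesis by simp
qed

lemma coef_pconst_pmonom: "coef (pconst c * pmonom m) m' = (if m' = m then c else 0)"
  by (simp add: pmonom_def pconst_mult lookup_single when_def)

text \<open>Distinct pairs of exponents give distinct monomials in the doubled variables, so no
  coefficients of the operator are merged.\<close>

lemma coef_symbol: "coef (symbol (weyl_op a)) (join_exp k) = coef a k"
proof -
  have "(\<Prod>i\<in>UNIV. pvar (Inl i) ^ coef (fst k') i) * (\<Prod>i\<in>UNIV. pvar (Inr i) ^ coef (snd k') i) =
      pmonom (join_exp k')" for k' :: "('a \<Rightarrow>\<^sub>0 nat) \<times> ('a \<Rightarrow>\<^sub>0 nat)"
    unfolding prod_pvar[symmetric] by (simp add: prod_Sum_UNIV)
  then have "symbol (weyl_op a) = (\<Sum>k'\<in>supp a. pconst (coef a k') * pmonom (join_exp k'))"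
    by (simp add: symbol_def case_prod_beta mult.assoc)
  then show ?thesis
    by (simp add: lookup_sum coef_pconst_pmonom join_exp_inject in_keys_iff)
qed

lemma coef_rescale:
  "coef (rescale \<mu> lam F) m = of_real (mpow (case_sum \<mu> lam) m) * coef F m"
proof -
  let ?c = "\<lambda>v. complex_of_real (case_sum \<mu> lam v)"
  have pconst_prod: "(\<Prod>v\<in>UNIV. pconst (g v)) = pconst (\<Prod>v\<in>UNIV. g v)" for g :: "'a + 'a \<Rightarrow> complex"
  proof -
    have "(\<Prod>v\<in>A. pconst (g v)) = pconst (\<Prod>v\<in>A. g v)" if "finite A" for A
      using that by (induction A rule: finite_induct) (simp_all add: pconst_def mult_single)
    then show ?thesis by simp
  qed
  have pconst_pow: "pconst c ^ n = pconst (c ^ n)" for c and n :: nat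
    by (induction n) (simp_all add: pconst_def mult_single)
  have subst_eq: "(case v of Inl i \<Rightarrow> pconst (of_real (\<mu> i)) * pvar (Inl i)
      | Inr i \<Rightarrow> pconst (of_real (lam i)) * pvar (Inr i)) = pconst (?c v) * pvar v" for v
    by (cases v) simp_all
  have "rescale \<mu> lam F = (\<Sum>m\<in>supp F. pconst (coef F m * of_real (mpow (case_sum \<mu> lam) m)) * pmonom m)"
    unfolding rescale_def psubst_def
  proof (intro sum.cong refl)
    fix m
    have "(\<Prod>v\<in>UNIV. (pconst (?c v) * pvar v) ^ coef m v) =
        pconst (of_real (mpow (case_sum \<mu> lam) m)) * pmonom m"
      by (simp add: power_mult_distrib prod.distrib prod_pvar pconst_pow pconst_prod mpow_def)
    then show "pconst (coef F m) * (\<Prod>v\<in>UNIV. (case v of Inl i \<Rightarrow> pconst (of_real (\<mu> i)) * pvar (Inl i)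
        | Inr i \<Rightarrow> pconst (of_real (lam i)) * pvar (Inr i)) ^ coef m v) =
      pconst (coef F m * of_real (mpow (case_sum \<mu> lam) m)) * pmonom m"
      unfolding subst_eq by (simp add: pconst_def pmonom_def mult_single)
  qed
  then show ?thesis
    by (simp add: lookup_sum coef_pconst_pmonom in_keys_iff)
qed

text \<open>The substitution acts diagonally on monomials, multiplying a coefficient by
  \<mu>^\<alpha> lam^\<beta>. Every exponent in the doubled variables splits into such a pair, so
  comparing at \<open>join_exp k\<close> suffices.\<close>

lemma rescale_symbol:
  fixes \<mu> lam :: "'n::finite \<Rightarrow> real" and a :: "'n weyl_coeffs"
  shows "rescale \<mu> lam (symbol (weyl_op a)) = symbol (weyl_op (wscale \<mu> lam a))"
proof (rule poly_mapping_eqI)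
  fix m :: "'n + 'n \<Rightarrow>\<^sub>0 nat"
  obtain k where m: "m = join_exp k" using ex_join_exp by blast
  have "mpow (case_sum \<mu> lam) (join_exp k) = mpow \<mu> (fst k) * mpow lam (snd k)"
    by (simp add: mpow_def prod_Sum_UNIV)
  then show "coef (rescale \<mu> lam (symbol (weyl_op a))) m = coef (symbol (weyl_op (wscale \<mu> lam a))) m"
    by (simp add: m coef_rescale coef_symbol coef_wscale)
qed

lemma weyl_op_eq_zero_iff: "weyl_op a = (\<lambda>_. 0) \<longleftrightarrow> a = 0"
proof -
  have "(\<lambda>_. 0) = weyl_op 0" by (simp add: fun_eq_iff weyl_op_0)
  then show ?thesis using inj_weyl_op by (metis injD)
qed

lemma symbol_weyl_op_0: "symbol (weyl_op 0) = 0"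
  by (simp add: symbol_def)

theorem theorem4p5:
  fixes \<mu> lam :: "'n::finite \<Rightarrow> real"
  assumes "\<forall>i. \<mu> i \<in> {0..1}" and "\<forall>i. lam i \<in> {0..1}"
  shows "(\<forall>F :: ('n + 'n) cpoly.
            F \<in> symbol ` real_stability_preservers \<longrightarrow>
            rescale \<mu> lam F \<in> symbol ` real_stability_preservers \<union> {0}) \<and>
         (\<forall>F :: ('n + 'n) cpoly.
            F \<in> symbol ` stability_preservers \<longrightarrow>
            rescale \<mu> lam F \<in> symbol ` stability_preservers \<union> {0})"
proof (intro conjI allI impI)
  fix F :: "('n + 'n) cpoly"
  have sc: "\<mu> i \<in> {0..1}" "lam i \<in> {0..1}" for i using assms by auto
  {
    assume "F \<in> symbol ` real_stability_preservers"
    then obtain a where F: "F = symbol (weyl_op a)" and a: "real_coeffs a"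
      and sub: "weyl_op a ` {f. real_stable f} \<subseteq> {f. real_stable f} \<union> {0}"
      by (auto simp: real_stability_preservers_def weyl_real_def)
    have pres: "real_stable (weyl_op a h) \<or> weyl_op a h = 0" if "real_stable h" for h
      using sub that by blast
    have "weyl_op (wscale \<mu> lam a) \<in> real_stability_preservers" if "wscale \<mu> lam a \<noteq> 0"
    proof -
      have "real_stable (weyl_op (wscale \<mu> lam a) f) \<or> weyl_op (wscale \<mu> lam a) f = 0"
        if "real_stable f" for f
        proof (cases "weyl_op (wscale \<mu> lam a) f = 0")
        case False
        then show ?thesis by (intro disjI1 wscale_preserves_real_stable pres a sc that)
      qed simp
      then show ?thesis
        using that a by (auto simp: real_stability_preservers_def weyl_real_def weyl_op_eq_zero_iff
            real_coeffs_wscale)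
    qed
    then show "rescale \<mu> lam F \<in> symbol ` real_stability_preservers \<union> {0}"
      unfolding F rescale_symbol by (cases "wscale \<mu> lam a = 0") (auto simp: symbol_weyl_op_0)
  next
    assume "F \<in> symbol ` stability_preservers"
    then obtain a where F: "F = symbol (weyl_op a)"
      and sub: "weyl_op a ` {f. stable f} \<subseteq> {f. stable f} \<union> {0}"
      by (auto simp: stability_preservers_def weyl_complex_def)
    have pres: "stable (weyl_op a h) \<or> weyl_op a h = 0" if "stable h" for h
      using sub that by blast
    have "weyl_op (wscale \<mu> lam a) \<in> stability_preservers" if "wscale \<mu> lam a \<noteq> 0"
    proof -
      have "stable (weyl_op (wscale \<mu> lam a) f) \<or> weyl_op (wscale \<mu> lam a) f = 0"
        if "stable f" for f
        proof (cases "weyl_op (wscale \<mu> lam a) f = 0")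
        case False
        then show ?thesis by (intro disjI1 wscale_preserves_stable pres sc that)
      qed simp
      then show ?thesis
        using that by (auto simp: stability_preservers_def weyl_complex_def weyl_op_eq_zero_iff)
    qed
    then show "rescale \<mu> lam F \<in> symbol ` stability_preservers \<union> {0}"
      unfolding F rescale_symbol by (cases "wscale \<mu> lam a = 0") (auto simp: symbol_weyl_op_0)
  }
qed

end
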